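(* Let $f\colon[0,1)\to\mathbb{R}_{\ge0}$ be Riemann integrable, let $\alpha\in\mathbb{R}^+$, let $(f_i)_{i\in\mathbb{N}}$ be non-negative Riemann integrable functions on $[0,1)$ converging uniformly to $f$, and let $(\alpha_i)_{i\in\mathbb{N}}$ be a sequence in $\mathbb{R}^+$ with $\alpha_i\to\alpha$ and $\alpha_i\ne\alpha$ for all $i$. Let $(y_i)_{i\in\mathbb{N}}$ be any sequence in $[0,1)$ and let $\mu_{y_i}=\sum_{z\in\mathbb{Z}}f_i(T_{\alpha_i}^z(y_i))\,\delta_z$ be the $f_i$-weighted return time measure with respect to $T_{\alpha_i}$ with reference point $y_i$. Then each $\gamma_{\mu_{y_i}}$ exists, the sequence $(\gamma_{\mu_{y_i}})_{i\in\mathbb{N}}$ converges vaguely to $$\gamma=\sum_{z\in\mathbb{Z}}\Xi(T_\alpha,\Lambda)(z)\,\delta_z,$$ and $$\widehat{\gamma}=\sum_{m\in\mathbb{Z}}\big|\widehat{f_\iota}(m)\big|^2\,\delta_{e^{2\pi i\alpha m}},\qquad \widehat{f_\iota}(m)=\int_0^1 f(t)e^{-2\pi i m t}\,dt .$$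
   Context: $T_\beta(x)=\{x+\beta\}$ on $[0,1)$ with $\{t\}$ the fractional part; $\Lambda$ is Lebesgue measure on $[0,1)$; $\Xi(T_\alpha,\Lambda)(z)=\int_0^1 f(T_\alpha^{-z}x)f(x)\,dx$. For a measure $\mu$ on $\mathbb{Z}$, $\widetilde{\mu}(A)=\overline{\mu(-A)}$, $\mu|_n$ is the restriction to $\{|x|\le n\}$, and the autocorrelation $\gamma_\mu$ is the vague limit of $\frac1{2n+1}\mu|_n*\widetilde{\mu|_n}$; vague convergence on $\mathbb{Z}$ means convergence of the mass at each point. $\mathbb{T}$ is the unit circle with normalised Haar measure $\omega_{\mathbb{T}}$, paired with $\mathbb{Z}$ by $(x,z)=x^z$. The diffraction $\widehat{\gamma}$ of a positive definite translation bounded measure $\gamma$ on $\mathbb{Z}$ is the unique measure on $\mathbb{T}$ with $\int\widehat{\varphi}\,d\gamma=\int\varphi\,d\widehat{\gamma}$ for all $\varphi=l*\widetilde{l}$, $l\in C(\mathbb{T})$, where $\widehat{\varphi}(z)=\int_{\mathbb{T}}\varphi(x)\overline{x^z}\,d\omega_{\mathbb{T}}(x)$ and $\widetilde{l}(x)=\overline{l(x^{-1})}$. *)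

theory Defs
  imports "HOL-Analysis.Analysis"
begin

definition riemann_int01 :: "(real \<Rightarrow> real) \<Rightarrow> bool" where
  "riemann_int01 f \<longleftrightarrow>
     bounded (f ` {0..<1}) \<and>
     (\<forall>\<epsilon>>0. \<exists>(n::nat) (x::nat \<Rightarrow> real).
        x 0 = 0 \<and> x n = 1 \<and> (\<forall>k<n. x k < x (Suc k)) \<and>
        (\<Sum>k<n. (Sup (f ` {x k..<x (Suc k)}) - Inf (f ` {x k..<x (Suc k)}))
                 * (x (Suc k) - x k)) < \<epsilon>)"

definition rot :: "real \<Rightarrow> real \<Rightarrow> real" where
  "rot \<beta> x = frac (x + \<beta>)"

definition rot_pow :: "real \<Rightarrow> int \<Rightarrow> real \<Rightarrow> real" where
  "rot_pow \<beta> z x = frac (x + of_int z * \<beta>)"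

section \<open>Measures on Z (given by their point masses, real-valued here)\<close>

definition return_measure :: "(real \<Rightarrow> real) \<Rightarrow> real \<Rightarrow> real \<Rightarrow> int \<Rightarrow> real" where
  "return_measure f \<beta> y z = f (rot_pow \<beta> z y)"

definition restr :: "(int \<Rightarrow> real) \<Rightarrow> nat \<Rightarrow> int \<Rightarrow> real" where
  "restr \<mu> n x = (if \<bar>x\<bar> \<le> int n then \<mu> x else 0)"

(* mass at z of (1/(2n+1)) mu|_n * tilde(mu|_n);  tilde nu {y} = conj(nu {-y}) = nu {-y} (real) *)
definition autocorr_approx :: "(int \<Rightarrow> real) \<Rightarrow> nat \<Rightarrow> int \<Rightarrow> real" where
  "autocorr_approx \<mu> n z =
     (\<Sum>x\<in>{- int n..int n}. restr \<mu> n x * restr \<mu> n (x - z)) / (2 * real n + 1)"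

definition autocorr_exists :: "(int \<Rightarrow> real) \<Rightarrow> bool" where
  "autocorr_exists \<mu> \<longleftrightarrow> (\<forall>z. convergent (\<lambda>n. autocorr_approx \<mu> n z))"

definition autocorr :: "(int \<Rightarrow> real) \<Rightarrow> int \<Rightarrow> real" where
  "autocorr \<mu> z = lim (\<lambda>n. autocorr_approx \<mu> n z)"

definition vague_conv :: "(nat \<Rightarrow> int \<Rightarrow> real) \<Rightarrow> (int \<Rightarrow> real) \<Rightarrow> bool" where
  "vague_conv \<gamma>s \<gamma> \<longleftrightarrow> (\<forall>z. (\<lambda>i. \<gamma>s i z) \<longlonglongrightarrow> \<gamma> z)"

definition translation_bounded :: "(int \<Rightarrow> real) \<Rightarrow> bool" where
  "translation_bounded \<gamma> \<longleftrightarrow>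
     (\<forall>K::int set. finite K \<longrightarrow> (\<exists>C. \<forall>x. (\<Sum>k\<in>K. \<bar>\<gamma> (x + k)\<bar>) \<le> C))"

(* gamma(g * tilde g) >= 0 for all finitely supported g : Z -> C *)
definition pos_def :: "(int \<Rightarrow> real) \<Rightarrow> bool" where
  "pos_def \<gamma> \<longleftrightarrow>
     (\<forall>(g::int \<Rightarrow> complex) (S::int set). finite S \<longrightarrow>
        (let s = (\<Sum>x\<in>S. \<Sum>y\<in>S. g x * cnj (g y) * complex_of_real (\<gamma> (x - y)))
         in Im s = 0 \<and> Re s \<ge> 0))"

definition circle :: "complex set" where
  "circle = sphere 0 1"

(* integral w.r.t. normalised Haar measure omega_T, via x = e^{2 pi i t}, t in [0,1) *)
definition circ_int :: "(complex \<Rightarrow> complex) \<Rightarrow> complex" where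
  "circ_int g = integral {0..1} (\<lambda>t. g (cis (2 * pi * t)))"

definition circ_fourier :: "(complex \<Rightarrow> complex) \<Rightarrow> int \<Rightarrow> complex" where
  "circ_fourier \<phi> z = circ_int (\<lambda>x. \<phi> x * cnj (x powi z))"

(* (l * tilde l)(x) = int_T l(y) tilde l(y^{-1} x) d omega(y),  tilde l(w) = conj(l(w^{-1})) *)
definition conv_tilde :: "(complex \<Rightarrow> complex) \<Rightarrow> complex \<Rightarrow> complex" where
  "conv_tilde l x = circ_int (\<lambda>y. l y * cnj (l (inverse (inverse y * x))))"

definition circle_borel :: "complex measure" where
  "circle_borel = restrict_space borel circle"

definition is_diffraction :: "(int \<Rightarrow> real) \<Rightarrow> complex measure \<Rightarrow> bool" where
  "is_diffraction \<gamma> \<nu> \<longleftrightarrow>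
     pos_def \<gamma> \<and> translation_bounded \<gamma> \<and>
     space \<nu> = circle \<and> sets \<nu> = sets circle_borel \<and>
     (\<forall>l. continuous_on circle l \<longrightarrow>
           ((\<lambda>z. norm (circ_fourier (conv_tilde l) z * complex_of_real (\<gamma> z))) summable_on (UNIV::int set)) \<and>
           integrable \<nu> (conv_tilde l) \<and>
           (\<Sum>\<^sub>\<infinity>z::int. circ_fourier (conv_tilde l) z * complex_of_real (\<gamma> z))
              = integral\<^sup>L \<nu> (conv_tilde l))"

definition Xi :: "(real \<Rightarrow> real) \<Rightarrow> real \<Rightarrow> int \<Rightarrow> real" where
  "Xi f \<alpha> z = integral {0..1} (\<lambda>x. f (rot_pow \<alpha> (- z) x) * f x)"

definition fourier01 :: "(real \<Rightarrow> real) \<Rightarrow> int \<Rightarrow> complex" where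
  "fourier01 f m = integral {0..1} (\<lambda>t. complex_of_real (f t) * cis (- 2 * pi * of_int m * t))"

definition pure_point_diffr :: "(real \<Rightarrow> real) \<Rightarrow> real \<Rightarrow> complex measure" where
  "pure_point_diffr f \<alpha> =
     distr (density (count_space (UNIV::int set)) (\<lambda>m. ennreal ((cmod (fourier01 f m))\<^sup>2)))
           circle_borel (\<lambda>m. cis (2 * pi * \<alpha> * of_int m))"

end

theory Submission
  imports Defs
begin

text \<open>
  A Riemann integrable function on the circle is sandwiched between trigonometric polynomials whose
  integrals differ by arbitrarily little. The average of the character \<open>e(mt)\<close> along an orbit of the
  rotation by \<open>\<beta>\<close> vanishes as soon as \<open>m\<beta>\<close> is not an integer. For irrational \<open>\<beta>\<close> this gives Weyl
  equidistribution; for rational \<open>\<beta>\<close> the orbit is periodic; so autocorrelations always exist. Since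
  \<open>\<alpha>\<^sub>i\<close> tends to \<open>\<alpha>\<close> without being equal to it, for each \<open>m \<noteq> 0\<close> eventually \<open>m\<alpha>\<^sub>i\<close> is not an integer,
  even when \<open>m\<alpha>\<close> is one. Hence the autocorrelations approach the integral \<open>\<integral> f(t) f(t - z\<alpha>) dt\<close>
  whether or not the \<open>\<alpha>\<^sub>i\<close> and \<open>\<alpha>\<close> are rational.

  By Parseval's identity in shifted form, \<open>\<integral> F(t) cnj F(t - s) dt = \<Sum>m. \<bar>c\<^sub>m\<bar>\<^sup>2 e(ms)\<close>, where
  \<open>c\<^sub>m\<close> are the Fourier coefficients of \<open>F\<close>. Applied to
  \<open>f\<close> it expands \<open>\<Xi>\<close>, applied to \<open>l\<close> it expands \<open>l * tilde l\<close>, and exchanging the two absolutely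
  convergent sums yields the diffraction formula.
\<close>

section \<open>Trigonometric polynomials\<close>

definition chr :: "int \<Rightarrow> real \<Rightarrow> complex" where
  "chr m t = cis (2 * pi * of_int m * t)"

lemma chr_0 [simp]: "chr 0 t = 1" and chr_at_0 [simp]: "chr m 0 = 1"
  by (simp_all add: chr_def)

lemma norm_chr [simp]: "cmod (chr m t) = 1"
  by (simp add: chr_def)

lemma chr_add: "chr m (s + t) = chr m s * chr m t"
  by (simp add: chr_def cis_mult algebra_simps)

lemma chr_diff: "chr m (t - s) = chr m t * chr (- m) s"
  by (simp add: chr_def cis_mult algebra_simps)

lemma chr_mult: "chr m t * chr k t = chr (m + k) t"
  by (simp add: chr_def cis_mult algebra_simps)

lemma cnj_chr: "cnj (chr m t) = chr (- m) t"
  by (simp add: chr_def cis_cnj)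

text \<open>Frequency and position trade places. This matches the Fourier series of
  \<open>Xi\<close> at \<open>z\<close> with that of \<open>conv_tilde l\<close> at the point mass
  of index \<open>m\<close>.\<close>

lemma chr_int_mult: "chr m (of_int z * t) = chr z (of_int m * t)"
  by (simp add: chr_def algebra_simps)

lemma chr_eq_1_iff: "chr m t = 1 \<longleftrightarrow> of_int m * t \<in> \<int>"
proof -
  have "cis (2 * pi * (of_int m * t)) = 1 \<longleftrightarrow> (\<exists>k::int. 2 * pi * (of_int m * t) = of_int (2 * k) * pi)"
    unfolding cis_conv_exp exp_eq_1 by simp
  also have "\<dots> \<longleftrightarrow> (\<exists>k::int. of_int m * t = of_int k)"
    by (auto simp: mult_ac)
  finally show ?thesis
    by (simp add: chr_def Ints_def mult.assoc image_iff)
qed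

lemma chr_frac [simp]: "chr m (frac t) = chr m t"
proof -
  have "chr m (real_of_int \<lfloor>t\<rfloor>) = 1"
    by (auto simp: chr_eq_1_iff intro: Ints_mult)
  then have "chr m (frac t + of_int \<lfloor>t\<rfloor>) = chr m (frac t)"
    by (simp only: chr_add) simp
  then show ?thesis by (simp add: frac_def)
qed

lemma continuous_on_chr [continuous_intros]:
  "continuous_on A g \<Longrightarrow> continuous_on A (\<lambda>t. chr m (g t))"
  unfolding chr_def by (intro continuous_intros)

lemma has_integral_chr: "(chr m has_integral (if m = 0 then 1 else 0)) {0..1}"
proof (cases "m = 0")
  case True
  then have "chr m = (\<lambda>_. 1)" by auto
  then show ?thesis using True has_integral_const_real[of "1::complex" 0 1] by simp
next
  case False
  define c where "c = \<i> * (2 * pi * of_int m)"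
  have c0: "c \<noteq> 0" using False by (simp add: c_def)
  have chr_exp: "chr m t = exp (c * of_real t)" for t
    by (simp add: chr_def c_def cis_conv_exp algebra_simps)
  have "((\<lambda>t. exp (c * of_real t)) has_integral (exp (c * of_real 1) / c - exp (c * of_real 0) / c)) {0..1}"
  proof (rule fundamental_theorem_of_calculus)
    fix x :: real
    show "((\<lambda>t. exp (c * of_real t) / c) has_vector_derivative exp (c * of_real x)) (at x within {0..1})"
      using c0
      by (intro has_vector_derivative_real_field[where f = "\<lambda>z. exp (c * z) / c"])
         (auto intro!: derivative_eq_intros)
  qed simp
  moreover have "exp (c * of_real 1) = 1"
    using chr_exp[of 1] chr_eq_1_iff[of m 1] by simp
  moreover have "chr m = (\<lambda>t. exp (c * of_real t))"
    using chr_exp by auto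
  ultimately show ?thesis using False by simp
qed

section \<open>Algebra of trigonometric polynomials\<close>

text \<open>The frequency set is carried explicitly because one finite set must later serve a whole
  family of shifted polynomials. Coefficients on it may vanish.\<close>

definition trig_poly :: "int set \<Rightarrow> (real \<Rightarrow> complex) \<Rightarrow> bool" where
  "trig_poly S P \<longleftrightarrow> finite S \<and> (\<exists>c. \<forall>t. P t = (\<Sum>m\<in>S. c m * chr m t))"

lemma trig_polyE:
  assumes "trig_poly S P"
  obtains c where "finite S" "P = (\<lambda>t. \<Sum>m\<in>S. c m * chr m t)"
  using assms unfolding trig_poly_def by auto

lemma trig_polyI: "finite S \<Longrightarrow> P = (\<lambda>t. \<Sum>m\<in>S. c m * chr m t) \<Longrightarrow> trig_poly S P"
  unfolding trig_poly_def by auto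

lemma trig_poly_mono:
  assumes "trig_poly S P" "S \<subseteq> S'" "finite S'" shows "trig_poly S' P"
proof -
  obtain c where c: "P = (\<lambda>t. \<Sum>m\<in>S. c m * chr m t)" using assms(1) by (rule trig_polyE)
  have "P = (\<lambda>t. \<Sum>m\<in>S'. (if m \<in> S then c m else 0) * chr m t)"
    unfolding c using assms(2,3) by (intro ext sum.mono_neutral_cong_left) auto
  with assms(3) show ?thesis by (rule trig_polyI)
qed

lemma trig_poly_const: "trig_poly {0} (\<lambda>_. a)"
  by (rule trig_polyI[where c = "\<lambda>_. a"]) auto

lemma trig_poly_chr: "trig_poly {m} (\<lambda>t. a * chr m t)"
  by (rule trig_polyI[where c = "\<lambda>_. a"]) auto

lemma trig_poly_add:
  assumes "trig_poly S P" "trig_poly S' P'" shows "trig_poly (S \<union> S') (\<lambda>t. P t + P' t)"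
proof -
  have fin: "finite (S \<union> S')" using assms by (auto simp: trig_poly_def)
  obtain c where c: "P = (\<lambda>t. \<Sum>m\<in>S \<union> S'. c m * chr m t)"
    using trig_poly_mono[OF assms(1) _ fin] by (auto elim: trig_polyE)
  obtain c' where c': "P' = (\<lambda>t. \<Sum>m\<in>S \<union> S'. c' m * chr m t)"
    using trig_poly_mono[OF assms(2) _ fin] by (auto elim: trig_polyE)
  show ?thesis
    by (rule trig_polyI[OF fin, where c = "\<lambda>m. c m + c' m"])
       (simp add: c c' sum.distrib distrib_right)
qed

lemma trig_poly_sum:
  assumes "finite A" "\<And>i. i \<in> A \<Longrightarrow> trig_poly (S i) (P i)"
  shows "trig_poly (\<Union>i\<in>A. S i) (\<lambda>t. \<Sum>i\<in>A. P i t)"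
  using assms
proof (induction A rule: finite_induct)
  case empty
  then show ?case by (auto simp: trig_poly_def)
next
  case (insert i A)
  then show ?case
    using trig_poly_add[of "S i" "P i" "\<Union>i\<in>A. S i" "\<lambda>t. \<Sum>i\<in>A. P i t"] by simp
qed

lemma trig_poly_cmult:
  assumes "trig_poly S P" shows "trig_poly S (\<lambda>t. a * P t)"
proof -
  obtain c where "finite S" and c: "P = (\<lambda>t. \<Sum>m\<in>S. c m * chr m t)" using assms by (rule trig_polyE)
  then show ?thesis
    by (intro trig_polyI[where c = "\<lambda>m. a * c m"]) (auto simp: sum_distrib_left mult.assoc)
qed

lemma trig_poly_mult:
  assumes "trig_poly S P" "trig_poly S' P'"
  shows "trig_poly (\<Union>m\<in>S. \<Union>k\<in>S'. {m + k}) (\<lambda>t. P t * P' t)"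
proof -
  obtain c where fin: "finite S" and c: "P = (\<lambda>t. \<Sum>m\<in>S. c m * chr m t)"
    using assms(1) by (rule trig_polyE)
  obtain c' where fin': "finite S'" and c': "P' = (\<lambda>t. \<Sum>m\<in>S'. c' m * chr m t)"
    using assms(2) by (rule trig_polyE)
  have "(\<lambda>t. P t * P' t) = (\<lambda>t. \<Sum>m\<in>S. \<Sum>k\<in>S'. (c m * c' k) * chr (m + k) t)"
    by (simp add: c c' sum_product chr_mult[symmetric] mult.assoc mult.left_commute)
  moreover have "trig_poly (\<Union>m\<in>S. \<Union>k\<in>S'. {m + k}) \<dots>"
    by (intro trig_poly_sum fin fin' trig_poly_chr)
  ultimately show ?thesis by simp
qed

lemma trig_poly_shift:
  assumes "trig_poly S P" shows "trig_poly S (\<lambda>t. P (t - s))"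
proof -
  obtain c where "finite S" and c: "P = (\<lambda>t. \<Sum>m\<in>S. c m * chr m t)" using assms by (rule trig_polyE)
  then show ?thesis
    by (intro trig_polyI[where c = "\<lambda>m. c m * chr (- m) s"]) (auto simp: chr_diff mult_ac)
qed

lemma trig_poly_cnj:
  assumes "trig_poly S P" shows "trig_poly (uminus ` S) (\<lambda>t. cnj (P t))"
proof -
  obtain c where "finite S" and c: "P = (\<lambda>t. \<Sum>m\<in>S. c m * chr m t)" using assms by (rule trig_polyE)
  then show ?thesis
    by (intro trig_polyI[where c = "\<lambda>m. cnj (c (- m))"])
       (auto simp: cnj_chr sum.reindex inj_on_def)
qed

lemma trig_poly_continuous:
  assumes "trig_poly S P" shows "continuous_on A P"
proof -
  obtain c where c: "P = (\<lambda>t. \<Sum>m\<in>S. c m * chr m t)" using assms by (rule trig_polyE)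
  show ?thesis unfolding c by (intro continuous_intros)
qed

lemma trig_poly_integrable: "trig_poly S P \<Longrightarrow> P integrable_on {0..1}"
  by (rule integrable_continuous_real[OF trig_poly_continuous])

lemma trig_poly_frac:
  assumes "trig_poly S P" shows "P (frac t) = P t"
  using assms by (elim trig_polyE) simp

lemma trig_poly_bounded:
  assumes "trig_poly S P" obtains B where "\<And>t. cmod (P t) \<le> B"
proof -
  obtain c where c: "P = (\<lambda>t. \<Sum>m\<in>S. c m * chr m t)" using assms by (rule trig_polyE)
  have "cmod (P t) \<le> (\<Sum>m\<in>S. cmod (c m))" for t
    unfolding c by (rule order_trans[OF norm_sum]) (simp add: norm_mult)
  then show ?thesis using that by blast
qed

lemma has_integral_trig_poly:
  assumes "finite S"
  shows "((\<lambda>t. \<Sum>m\<in>S. c m * chr m t) has_integral (if 0 \<in> S then c 0 else 0)) {0..1}"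
proof -
  have "((\<lambda>t. \<Sum>m\<in>S. c m * chr m t) has_integral (\<Sum>m\<in>S. c m * (if m = 0 then 1 else 0))) {0..1}"
    by (intro has_integral_sum has_integral_mult_right has_integral_chr assms)
  then show ?thesis using assms by (simp add: if_distrib cong: if_cong)
qed

lemma trig_poly_integral_shift:
  assumes "trig_poly S P"
  shows "integral {0..1} (\<lambda>t. P (t - s)) = integral {0..1} P"
proof -
  obtain c where fin: "finite S" and c: "P = (\<lambda>t. \<Sum>m\<in>S. c m * chr m t)"
    using assms by (rule trig_polyE)
  have "(\<lambda>t. P (t - s)) = (\<lambda>t. \<Sum>m\<in>S. (c m * chr (- m) s) * chr m t)"
    by (auto simp: c chr_diff mult_ac)
  then show ?thesis
    using integral_unique[OF has_integral_trig_poly[OF fin, of "\<lambda>m. c m * chr (- m) s"]]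
      integral_unique[OF has_integral_trig_poly[OF fin, of c]] c by simp
qed

section \<open>Functions sandwiched between trigonometric polynomials\<close>

text \<open>On the unit circle a real linear form is a combination of cosine and sine, hence of the
  characters of frequency 1 and -1; constants, sums and products stay trigonometric.\<close>

lemma trig_poly_real_polynomial_function:
  assumes "real_polynomial_function p"
  shows "\<exists>S. trig_poly S (\<lambda>t. complex_of_real (p (cis (2 * pi * t))))"
  using assms
proof (induction p rule: real_polynomial_function.induct)
  case (linear f)
  interpret bounded_linear f by fact
  have "complex_of_real (f (cis (2 * pi * t)))
      = (of_real (f 1) - \<i> * of_real (f \<i>)) / 2 * chr 1 t + (of_real (f 1) + \<i> * of_real (f \<i>)) / 2 * chr (- 1) t"
    for t
  proof -
    have "cis (2 * pi * t) = cos (2 * pi * t) *\<^sub>R 1 + sin (2 * pi * t) *\<^sub>R \<i>"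
      by (simp add: complex_eq_iff)
    then have "f (cis (2 * pi * t)) = cos (2 * pi * t) * f 1 + sin (2 * pi * t) * f \<i>"
      by (simp only: add scaleR) simp
    then show ?thesis
      by (simp add: chr_def complex_eq_iff field_simps)
  qed
  then show ?case
    by (intro exI[of _ "{1} \<union> {- 1}"]) (simp only: trig_poly_add[OF trig_poly_chr trig_poly_chr])
next
  case (const c)
  then show ?case using trig_poly_const by blast
next
  case (add f g)
  then show ?case using trig_poly_add by fastforce
next
  case (mult f g)
  then show ?case using trig_poly_mult by fastforce
qed

lemma circle_continuous_approx:
  fixes l :: "complex \<Rightarrow> complex"
  assumes "continuous_on (sphere 0 1) l" "e > 0"
  obtains S P where "trig_poly S P" "\<And>t. cmod (l (cis (2 * pi * t)) - P t) < e"
proof -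
  obtain g :: "complex \<Rightarrow> complex"
    where g: "polynomial_function g" and lg: "\<forall>x\<in>sphere 0 1. cmod (l x - g x) < e"
    using Stone_Weierstrass_polynomial_function[OF _ assms] by auto
  have "real_polynomial_function (Re \<circ> g)" "real_polynomial_function (Im \<circ> g)"
    using g bounded_linear_Re bounded_linear_Im unfolding polynomial_function_def by blast+
  from this[THEN trig_poly_real_polynomial_function] obtain S S' where
    "trig_poly S (\<lambda>t. complex_of_real (Re (g (cis (2 * pi * t)))))"
    "trig_poly S' (\<lambda>t. complex_of_real (Im (g (cis (2 * pi * t)))))"
    by auto
  from trig_poly_add[OF this(1) trig_poly_cmult[OF this(2), of \<i>]]
  have "trig_poly (S \<union> S') (\<lambda>t. g (cis (2 * pi * t)))"
    by (simp flip: complex_eq)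
  then show ?thesis using that lg by simp
qed

lemma loop_approx:
  fixes u :: "real \<Rightarrow> complex"
  assumes "continuous_on {0..1} u" "u 0 = u 1" "e > 0"
  obtains S P where "trig_poly S P" "\<And>t. cmod (u (frac t) - P t) < e"
proof -
  \<comment> \<open>The loop descends to the circle through \<open>Arg2pi\<close>, which jumps at 1.
    Continuity there rests on \<open>u 0 = u 1\<close>; it is read off from the constant homotopy of
    \<open>u\<close> with itself.\<close>
  have "homotopic_loops UNIV u u"
    using assms by (simp add: homotopic_loops_refl path_def pathstart_def pathfinish_def)
  from homotopic_loops_imp_homotopic_circlemaps[OF this]
  have "continuous_on (sphere 0 1) (u \<circ> (\<lambda>z. Arg2pi z / (2 * pi)))"
    using homotopic_with_imp_continuous by blast
  then obtain S P where P: "trig_poly S P"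
    "\<And>t. cmod ((u \<circ> (\<lambda>z. Arg2pi z / (2 * pi))) (cis (2 * pi * t)) - P t) < e"
    using circle_continuous_approx assms(3) by blast
  have "Arg2pi (cis (2 * pi * t)) = 2 * pi * frac t" for t
  proof -
    have "cis (2 * pi * t) = cis (2 * pi * frac t)"
      using chr_frac[of 1 t] by (simp add: chr_def)
    moreover have "Arg2pi (cis (2 * pi * frac t)) = 2 * pi * frac t"
      by (rule Arg2pi_unique[of 1]) (simp_all add: cis_conv_exp frac_lt_1)
    ultimately show ?thesis by simp
  qed
  then show ?thesis using that P by simp
qed

text \<open>For bounded 1-periodic functions this is Riemann integrability on \<open>[0,1)\<close>.\<close>

definition trig_sandwiched :: "(real \<Rightarrow> complex) \<Rightarrow> bool" where
  "trig_sandwiched F \<longleftrightarrow> (\<forall>e>0. \<exists>S P S' Q. trig_poly S P \<and> trig_poly S' Q \<and>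
     (\<forall>t. cmod (F t - P t) \<le> Re (Q t)) \<and> Re (integral {0..1} Q) < e)"

lemma trig_sandwichedE:
  assumes "trig_sandwiched F" "e > 0"
  obtains S P S' Q where "trig_poly S P" "trig_poly S' Q"
    "\<And>t. cmod (F t - P t) \<le> Re (Q t)" "Re (integral {0..1} Q) < e"
  using assms unfolding trig_sandwiched_def by blast

lemma trig_sandwiched_bounded:
  assumes "trig_sandwiched F" obtains B where "B > 0" "\<And>t. cmod (F t) \<le> B"
proof -
  obtain S P S' Q where *: "trig_poly S P" "trig_poly S' Q" "\<And>t. cmod (F t - P t) \<le> Re (Q t)"
    using trig_sandwichedE[OF assms zero_less_one] by metis
  obtain B where B: "\<And>t. cmod (P t) \<le> B" using trig_poly_bounded[OF *(1)] by blast
  obtain B' where B': "\<And>t. cmod (Q t) \<le> B'" using trig_poly_bounded[OF *(2)] by blast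
  have le: "cmod (F t) \<le> B + B'" for t
    using norm_triangle_ineq[of "F t - P t" "P t"] *(3)[of t] B[of t] B'[of t]
      complex_Re_le_cmod[of "Q t"] by simp
  have "0 \<le> B + B'" using le[of 0] norm_ge_zero order_trans by blast
  then show ?thesis using le add_increasing2[OF zero_le_one le] by (intro that[of "B + B' + 1"]) auto
qed

section \<open>Integrability and closure properties of sandwiched functions\<close>

lemma Re_integral: "g integrable_on A \<Longrightarrow> Re (integral A g) = integral A (\<lambda>t. Re (g t))"
  using integral_linear[OF _ bounded_linear_Re, of g A] by (simp add: o_def)

lemma Re_integrable: "g integrable_on A \<Longrightarrow> (\<lambda>t. Re (g t)) integrable_on A"
  using integrable_linear[OF _ bounded_linear_Re, of g A] by (simp add: o_def)

lemma cmod_integral_le: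
  assumes "g integrable_on {0..1}" "Q integrable_on {0..1}" "\<And>t. cmod (g t) \<le> Re (Q t)"
  shows "cmod (integral {0..1::real} g) \<le> Re (integral {0..1} Q)"
  using integral_norm_bound_integral[OF assms(1) Re_integrable[OF assms(2)]] assms(3)
  by (simp add: Re_integral[OF assms(2)])

lemma trig_sandwiched_integrable:
  assumes "trig_sandwiched F" shows "F integrable_on {0..1}"
proof -
  \<comment> \<open>Here \<open>g\<close> stands for \<open>Re\<close> or \<open>Im\<close>. The
    bound by \<open>cmod\<close> places \<open>g (F t)\<close> between
    \<open>g (P t) - Re (Q t)\<close> and \<open>g (P t) + Re (Q t)\<close>, whose integrals differ
    by less than \<open>e\<close>.\<close>
  have *: "(\<lambda>t. g (F t)) integrable_on {0..1}"
    if g: "bounded_linear g" "\<And>z. \<bar>g z\<bar> \<le> cmod z" for g :: "complex \<Rightarrow> real"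
  proof (rule integrable_straddle)
    fix e :: real assume "e > 0"
    then obtain S P S' Q where PQ: "trig_poly S P" "trig_poly S' Q"
      "\<And>t. cmod (F t - P t) \<le> Re (Q t)" "Re (integral {0..1} Q) < e / 2"
      using trig_sandwichedE[OF assms, of "e / 2"] by (metis half_gt_zero)
    interpret bounded_linear g by fact
    have P: "(\<lambda>t. g (P t)) integrable_on {0..1}"
      using integrable_linear[OF trig_poly_integrable[OF PQ(1)] g(1)] by (simp add: o_def)
    note Q = Re_integrable[OF trig_poly_integrable[OF PQ(2)]]
    have bd: "\<bar>g (F t) - g (P t)\<bar> \<le> Re (Q t)" for t
      using g(2)[of "F t - P t"] PQ(3)[of t] by (simp add: diff)
    have "0 \<le> integral {0..1} (\<lambda>t. Re (Q t))"
      using bd by (intro integral_nonneg Q) (meson abs_ge_zero order_trans)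
    moreover have "integral {0..1} (\<lambda>t. Re (Q t)) < e / 2"
      using PQ(4) Re_integral[OF trig_poly_integrable[OF PQ(2)]] by simp
    ultimately show "\<exists>h k i j. (h has_integral i) {0..1} \<and> (k has_integral j) {0..1} \<and>
        \<bar>i - j\<bar> < e \<and> (\<forall>x\<in>{0..1}. h x \<le> g (F x) \<and> g (F x) \<le> k x)"
      using has_integral_diff[OF integrable_integral[OF P] integrable_integral[OF Q]]
        has_integral_add[OF integrable_integral[OF P] integrable_integral[OF Q]] bd
      by (intro exI[of _ "\<lambda>t. g (P t) - Re (Q t)"] exI[of _ "\<lambda>t. g (P t) + Re (Q t)"] exI conjI)
         (auto simp: abs_le_iff algebra_simps)
  qed
  have "(\<lambda>t. of_real (Re (F t)) + \<i> * of_real (Im (F t))) integrable_on {0..1}"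
    using *[OF bounded_linear_Re abs_Re_le_cmod] *[OF bounded_linear_Im abs_Im_le_cmod]
      integrable_linear[OF _ bounded_linear_of_real]
    by (intro integrable_add integrable_on_mult_right) (auto simp: o_def)
  then show ?thesis by (simp flip: complex_eq)
qed

lemma trig_poly_trig_sandwiched:
  assumes "trig_poly S P" shows "trig_sandwiched P"
  unfolding trig_sandwiched_def
proof (intro allI impI)
  fix e :: real assume "e > 0"
  then show "\<exists>S P' S' Q. trig_poly S P' \<and> trig_poly S' Q \<and>
     (\<forall>t. cmod (P t - P' t) \<le> Re (Q t)) \<and> Re (integral {0..1} Q) < e"
    using assms trig_poly_const[of 0] by (intro exI[of _ S] exI[of _ P] exI[of _ "{0}"] exI[of _ "\<lambda>_. 0"]) auto
qed

text \<open>Approximation may be done in stages: the centre and the error function need only be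
  sandwiched themselves, which permits piecewise constructions.\<close>

lemma trig_sandwiched_approx:
  assumes "\<And>e. e > 0 \<Longrightarrow> \<exists>G W. trig_sandwiched G \<and> trig_sandwiched W \<and> (\<forall>t. cmod (F t - G t) \<le> Re (W t)) \<and> Re (integral {0..1} W) < e"
  shows "trig_sandwiched F"
  unfolding trig_sandwiched_def
proof (intro allI impI)
  fix e :: real assume "e > 0"
  then have e4: "e / 4 > 0" by simp
  then obtain G W where G: "trig_sandwiched G" and W: "trig_sandwiched W"
    and FG: "\<And>t. cmod (F t - G t) \<le> Re (W t)" and We: "Re (integral {0..1} W) < e / 4"
    using assms by blast
  obtain S P S' Q where PQ: "trig_poly S P" "trig_poly S' Q"
      "\<And>t. cmod (G t - P t) \<le> Re (Q t)" "Re (integral {0..1} Q) < e / 4"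
    using trig_sandwichedE[OF G e4] by blast
  obtain T R T' V where RV: "trig_poly T R" "trig_poly T' V"
      "\<And>t. cmod (W t - R t) \<le> Re (V t)" "Re (integral {0..1} V) < e / 4"
    using trig_sandwichedE[OF W e4] by blast
  note int = trig_poly_integrable[OF PQ(2)] trig_poly_integrable[OF RV(1)] trig_poly_integrable[OF RV(2)]
    trig_sandwiched_integrable[OF W]
  \<comment> \<open>The error \<open>W\<close> is replaced by \<open>R + V\<close>, whose real part
    dominates that of \<open>W\<close>. Bounding the integral of \<open>R\<close> by those of
    \<open>W\<close> and \<open>V\<close> uses two quarters of \<open>e\<close>; \<open>V\<close>
    and \<open>Q\<close> use the other two.\<close>
  have "cmod (F t - P t) \<le> Re (R t + V t + Q t)" for t
    using norm_triangle_ineq[of "F t - G t" "G t - P t"] FG[of t] PQ(3)[of t] RV(3)[of t]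
      complex_Re_le_cmod[of "W t - R t"] by simp
  moreover have "Re (integral {0..1} (\<lambda>t. R t + V t + Q t)) < e"
  proof -
    have "cmod (integral {0..1} (\<lambda>t. W t - R t)) \<le> Re (integral {0..1} V)"
      using int RV(3) by (intro cmod_integral_le integrable_diff) auto
    then have "Re (integral {0..1} R) < e / 2"
      using int RV(4) We complex_Re_le_cmod[of "integral {0..1} R - integral {0..1} W"]
      by (simp add: integral_diff norm_minus_commute)
    then show ?thesis using int PQ(4) RV(4) by (simp add: integral_add integrable_add)
  qed
  ultimately show "\<exists>S P S' Q. trig_poly S P \<and> trig_poly S' Q \<and>
     (\<forall>t. cmod (F t - P t) \<le> Re (Q t)) \<and> Re (integral {0..1} Q) < e"
    using PQ(1) trig_poly_add[OF trig_poly_add[OF RV(1) RV(2)] PQ(2)] by blast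
qed

lemma trig_sandwiched_uniform_approx:
  assumes "\<And>e. e > 0 \<Longrightarrow> \<exists>S P. trig_poly S P \<and> (\<forall>t. cmod (F t - P t) < e)"
  shows "trig_sandwiched F"
proof (rule trig_sandwiched_approx)
  fix e :: real assume "e > 0"
  then obtain S P where "trig_poly S P" "\<And>t. cmod (F t - P t) < e / 2"
    using assms[of "e / 2"] by auto
  then show "\<exists>G W. trig_sandwiched G \<and> trig_sandwiched W \<and> (\<forall>t. cmod (F t - G t) \<le> Re (W t)) \<and> Re (integral {0..1} W) < e"
    using trig_poly_trig_sandwiched[OF trig_poly_const, of "of_real (e / 2)"] trig_poly_trig_sandwiched \<open>e > 0\<close>
    by (intro exI[of _ P] exI[of _ "\<lambda>_. of_real (e / 2)"]) (auto simp: less_imp_le)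
qed

lemma trig_sandwiched_add:
  assumes "trig_sandwiched F" "trig_sandwiched G" shows "trig_sandwiched (\<lambda>t. F t + G t)"
  unfolding trig_sandwiched_def
proof (intro allI impI)
  fix e :: real assume "e > 0"
  then obtain S P S' Q where PQ: "trig_poly S P" "trig_poly S' Q"
      "\<And>t. cmod (F t - P t) \<le> Re (Q t)" "Re (integral {0..1} Q) < e / 2"
    using trig_sandwichedE[OF assms(1) half_gt_zero] by blast
  obtain T R T' V where RV: "trig_poly T R" "trig_poly T' V"
      "\<And>t. cmod (G t - R t) \<le> Re (V t)" "Re (integral {0..1} V) < e / 2"
    using trig_sandwichedE[OF assms(2) half_gt_zero] \<open>e > 0\<close> by blast
  have "cmod (F t + G t - (P t + R t)) \<le> Re (Q t + V t)" for t
    using norm_triangle_ineq[of "F t - P t" "G t - R t"] PQ(3)[of t] RV(3)[of t]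
    by (simp add: algebra_simps)
  moreover have "Re (integral {0..1} (\<lambda>t. Q t + V t)) < e"
    using PQ(2,4) RV(2,4) by (simp add: integral_add trig_poly_integrable)
  ultimately show "\<exists>S P S' Q. trig_poly S P \<and> trig_poly S' Q \<and>
     (\<forall>t. cmod (F t + G t - P t) \<le> Re (Q t)) \<and> Re (integral {0..1} Q) < e"
    using trig_poly_add[OF PQ(1) RV(1)] trig_poly_add[OF PQ(2) RV(2)] by blast
qed

lemma trig_sandwiched_shift:
  assumes "trig_sandwiched F" shows "trig_sandwiched (\<lambda>t. F (t - s))"
  unfolding trig_sandwiched_def
proof (intro allI impI)
  fix e :: real assume "e > 0"
  then obtain S P S' Q where PQ: "trig_poly S P" "trig_poly S' Q"
      "\<And>t. cmod (F t - P t) \<le> Re (Q t)" "Re (integral {0..1} Q) < e"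
    using trig_sandwichedE[OF assms] by blast
  then show "\<exists>S P S' Q. trig_poly S P \<and> trig_poly S' Q \<and>
     (\<forall>t. cmod (F (t - s) - P t) \<le> Re (Q t)) \<and> Re (integral {0..1} Q) < e"
    using trig_poly_shift[OF PQ(1), of s] trig_poly_shift[OF PQ(2), of s]
      trig_poly_integral_shift[OF PQ(2), of s] by fastforce
qed

lemma trig_sandwiched_cnj:
  assumes "trig_sandwiched F" shows "trig_sandwiched (\<lambda>t. cnj (F t))"
  unfolding trig_sandwiched_def
proof (intro allI impI)
  fix e :: real assume "e > 0"
  then obtain S P S' Q where PQ: "trig_poly S P" "trig_poly S' Q"
      "\<And>t. cmod (F t - P t) \<le> Re (Q t)" "Re (integral {0..1} Q) < e"
    using trig_sandwichedE[OF assms] by blast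
  moreover have "cmod (cnj (F t) - cnj (P t)) = cmod (F t - P t)" for t
    by (metis complex_cnj_diff complex_mod_cnj)
  ultimately show "\<exists>S P S' Q. trig_poly S P \<and> trig_poly S' Q \<and>
     (\<forall>t. cmod (cnj (F t) - P t) \<le> Re (Q t)) \<and> Re (integral {0..1} Q) < e"
    using trig_poly_cnj[OF PQ(1)] by fastforce
qed

lemma trig_sandwiched_mult:
  assumes F: "trig_sandwiched F" and G: "trig_sandwiched G" shows "trig_sandwiched (\<lambda>t. F t * G t)"
  unfolding trig_sandwiched_def
proof (intro allI impI)
  fix e :: real assume "e > 0"
  obtain B where B: "B > 0" "\<And>t. cmod (F t) \<le> B" using trig_sandwiched_bounded[OF F] by blast
  have "e / (2 * B) > 0" using \<open>e > 0\<close> \<open>B > 0\<close> by simp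
  then obtain T R T' V where RV: "trig_poly T R" "trig_poly T' V"
      "\<And>t. cmod (G t - R t) \<le> Re (V t)" "Re (integral {0..1} V) < e / (2 * B)"
    using trig_sandwichedE[OF G] by blast
  obtain C' where C': "\<And>t. cmod (R t) \<le> C'" using trig_poly_bounded[OF RV(1)] by blast
  define C where "C = max C' 1"
  have C: "C > 0" "\<And>t. cmod (R t) \<le> C" using C' by (auto simp: C_def le_max_iff_disj)
  \<comment> \<open>The approximant of \<open>F\<close> is chosen after that of \<open>G\<close>,
    because its tolerance depends on the bound \<open>C\<close> for \<open>R\<close>.\<close>
  have "e / (2 * C) > 0" using \<open>e > 0\<close> \<open>C > 0\<close> by simp
  then obtain S P S' Q where PQ: "trig_poly S P" "trig_poly S' Q"
      "\<And>t. cmod (F t - P t) \<le> Re (Q t)" "Re (integral {0..1} Q) < e / (2 * C)"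
    using trig_sandwichedE[OF F] by blast
  have "cmod (F t * G t - P t * R t) \<le> Re (of_real B * V t + of_real C * Q t)" for t
  proof -
    have "F t * G t - P t * R t = F t * (G t - R t) + R t * (F t - P t)"
      by (simp add: algebra_simps)
    then have "cmod (F t * G t - P t * R t) \<le> cmod (F t) * cmod (G t - R t) + cmod (R t) * cmod (F t - P t)"
      by (metis norm_mult norm_triangle_ineq)
    also have "\<dots> \<le> B * Re (V t) + C * Re (Q t)"
      using B C PQ(3)[of t] RV(3)[of t] by (intro add_mono mult_mono) auto
    finally show ?thesis by simp
  qed
  moreover have "Re (integral {0..1} (\<lambda>t. of_real B * V t + of_real C * Q t)) < e"
  proof -
    have "Re (integral {0..1} (\<lambda>t. of_real B * V t + of_real C * Q t))
        = B * Re (integral {0..1} V) + C * Re (integral {0..1} Q)"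
      using trig_poly_integrable[OF PQ(2)] trig_poly_integrable[OF RV(2)]
      by (simp add: integral_add integrable_on_mult_right)
    moreover have "B * Re (integral {0..1} V) < e / 2" "C * Re (integral {0..1} Q) < e / 2"
      using PQ(4) RV(4) B(1) C(1) by (simp_all add: field_simps)
    ultimately show ?thesis by simp
  qed
  ultimately show "\<exists>S P S' Q. trig_poly S P \<and> trig_poly S' Q \<and>
     (\<forall>t. cmod (F t * G t - P t) \<le> Re (Q t)) \<and> Re (integral {0..1} Q) < e"
    using trig_poly_mult[OF PQ(1) RV(1)]
      trig_poly_add[OF trig_poly_cmult[OF RV(2)] trig_poly_cmult[OF PQ(2)]] by blast
qed

lemma trig_sandwiched_const: "trig_sandwiched (\<lambda>_. a)"
  using trig_poly_trig_sandwiched[OF trig_poly_const] .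

lemma trig_sandwiched_cmult: "trig_sandwiched F \<Longrightarrow> trig_sandwiched (\<lambda>t. a * F t)"
  by (rule trig_sandwiched_mult[OF trig_sandwiched_const])

lemma trig_sandwiched_diff: "trig_sandwiched F \<Longrightarrow> trig_sandwiched G \<Longrightarrow> trig_sandwiched (\<lambda>t. F t - G t)"
  using trig_sandwiched_add[OF _ trig_sandwiched_cmult[of G "- 1"], of F] by simp

lemma trig_sandwiched_sum: "(\<And>i. i \<in> A \<Longrightarrow> trig_sandwiched (F i)) \<Longrightarrow> trig_sandwiched (\<lambda>t. \<Sum>i\<in>A. F i t)"
  by (induction A rule: infinite_finite_induct) (auto intro: trig_sandwiched_const trig_sandwiched_add)

text \<open>For trigonometric polynomials only frequency 0 contributes, and it is invariant under
  shifts. A nonzero discrepancy \<open>d\<close> would be at most twice the integral of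
  \<open>Q\<close>, which can be made smaller than \<open>d\<close>.\<close>

lemma trig_sandwiched_integral_shift:
  assumes "trig_sandwiched F" shows "integral {0..1} (\<lambda>t. F (t - s)) = integral {0..1} F"
proof (rule ccontr)
  define d where "d = cmod (integral {0..1} (\<lambda>t. F (t - s)) - integral {0..1} F)"
  assume "\<not> ?thesis"
  then have "d > 0" by (simp add: d_def)
  then obtain S P S' Q where PQ: "trig_poly S P" "trig_poly S' Q"
      "\<And>t. cmod (F t - P t) \<le> Re (Q t)" "Re (integral {0..1} Q) < d / 2"
    using trig_sandwichedE[OF assms half_gt_zero] by blast
  note int = trig_sandwiched_integrable[OF assms] trig_sandwiched_integrable[OF trig_sandwiched_shift[OF assms, of s]]
    trig_poly_integrable[OF PQ(1)] trig_poly_integrable[OF PQ(2)]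
    trig_poly_integrable[OF trig_poly_shift[OF PQ(1), of s]]
    trig_poly_integrable[OF trig_poly_shift[OF PQ(2), of s]]
  have "cmod (integral {0..1} (\<lambda>t. F t - P t)) \<le> Re (integral {0..1} Q)"
    using int PQ(3) by (intro cmod_integral_le integrable_diff) auto
  moreover have "cmod (integral {0..1} (\<lambda>t. F (t - s) - P (t - s))) \<le> Re (integral {0..1} (\<lambda>t. Q (t - s)))"
    using int PQ(3) by (intro cmod_integral_le integrable_diff) auto
  moreover have "integral {0..1} (\<lambda>t. F (t - s)) - integral {0..1} F
     = integral {0..1} (\<lambda>t. F (t - s) - P (t - s)) - integral {0..1} (\<lambda>t. F t - P t)"
    using int by (simp add: integral_diff trig_poly_integral_shift[OF PQ(1)])
  ultimately have "d \<le> Re (integral {0..1} Q) + Re (integral {0..1} Q)"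
    unfolding d_def trig_poly_integral_shift[OF PQ(2)] by (smt (verit) norm_triangle_ineq4)
  then show False using PQ(4) by simp
qed

section \<open>From loops and the sawtooth to Riemann integrable functions\<close>

lemma integral_frac: "integral {0..1} (\<lambda>t. g (frac t)) = integral {0..1} (g :: real \<Rightarrow> 'a::banach)"
  by (rule integral_spike[of "{1}"]) (auto simp: frac_eq)

lemma trig_sandwiched_loop:
  assumes "continuous_on {0..1} u" "u 0 = u 1" shows "trig_sandwiched (\<lambda>t. u (frac t))"
proof (rule trig_sandwiched_uniform_approx)
  fix e :: real assume "e > 0"
  then show "\<exists>S P. trig_poly S P \<and> (\<forall>t. cmod (u (frac t) - P t) < e)"
    using loop_approx[OF assms] by metis
qed

text \<open>The sawtooth \<open>x\<close> is approximated by \<open>x - x ^ n\<close>, which takes equal values at 0 and 1; the error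
  \<open>x ^ n\<close> is at most \<open>x ^ n + (1 - x) ^ n\<close>, which has the same property and integral \<open>2 / (n + 1)\<close>.\<close>

lemma trig_sandwiched_frac: "trig_sandwiched (\<lambda>t. of_real (frac t))"
proof (rule trig_sandwiched_approx)
  fix e :: real assume "e > 0"
  then obtain N :: nat where N: "2 / e < real N" using reals_Archimedean2 by blast
  \<comment> \<open>A positive exponent gives \<open>0 ^ n = 0\<close>, so \<open>x - x ^ n\<close>
    vanishes at both ends of the interval.\<close>
  define n where "n = Suc N"
  define W :: "real \<Rightarrow> complex" where "W x = of_real (x ^ n + (1 - x) ^ n)" for x
  have "((\<lambda>x. x ^ n + (1 - x) ^ n) has_integral
      ((1 ^ Suc n - (1 - 1) ^ Suc n) / Suc n - (0 ^ Suc n - (1 - 0) ^ Suc n) / Suc n)) {0..1::real}"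
  proof (rule fundamental_theorem_of_calculus)
    fix x :: real
    have "((\<lambda>x. (x ^ Suc n - (1 - x) ^ Suc n) / Suc n) has_real_derivative
       (real (Suc n) * x ^ n + real (Suc n) * (1 - x) ^ n) / Suc n) (at x within {0..1})"
      by (rule derivative_eq_intros refl | simp)+
    then show "((\<lambda>x. (x ^ Suc n - (1 - x) ^ Suc n) / Suc n) has_vector_derivative
       x ^ n + (1 - x) ^ n) (at x within {0..1})"
      unfolding has_real_derivative_iff_has_vector_derivative[symmetric]
      by (simp add: distrib_left[symmetric] del: of_nat_Suc)
  qed simp
  then have "((\<lambda>x. x ^ n + (1 - x) ^ n) has_integral 2 / Suc n) {0..1::real}"
    by (simp add: add_divide_distrib[symmetric])
  from has_integral_linear[OF this bounded_linear_of_real[where 'a = complex]]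
  have "integral {0..1} W = of_real (2 / Suc n)"
    unfolding W_def by (intro integral_unique) (simp add: o_def)
  moreover have "2 / Suc n < e"
  proof -
    have "2 / e < Suc n" using N by (simp add: n_def)
    then show ?thesis using \<open>e > 0\<close> by (simp add: field_simps)
  qed
  ultimately have "Re (integral {0..1} (\<lambda>t. W (frac t))) < e"
    by (simp add: integral_frac)
  moreover have "trig_sandwiched (\<lambda>t. W (frac t))"
    unfolding W_def by (intro trig_sandwiched_loop continuous_intros) (simp add: n_def)
  moreover have "trig_sandwiched (\<lambda>t. of_real (frac t - frac t ^ n))"
    by (rule trig_sandwiched_loop[where u = "\<lambda>x. of_real (x - x ^ n)"]) (auto intro!: continuous_intros simp: n_def)
  moreover have "cmod (of_real (frac t) - of_real (frac t - frac t ^ n)) \<le> Re (W (frac t))" for t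
    using frac_lt_1[of t] by (simp add: W_def norm_power)
  ultimately show "\<exists>G W. trig_sandwiched G \<and> trig_sandwiched W \<and> (\<forall>t. cmod (of_real (frac t) - G t) \<le> Re (W t))
      \<and> Re (integral {0..1} W) < e"
    by blast
qed

text \<open>The slopes of the two shifted sawtooths cancel, and only their unit jumps at
  \<open>a\<close> and \<open>b\<close> remain.\<close>

lemma indicator_frac:
  fixes a b t :: real
  assumes "0 \<le> a" "a \<le> b" "b \<le> 1"
  shows "indicator {a..<b} (frac t) = b - a + frac (t - b) - frac (t - a)"
proof -
  define u where "u = frac t"
  have u: "0 \<le> u" "u < 1" "t = u + of_int \<lfloor>t\<rfloor>"
    by (auto simp: u_def frac_lt_1) (simp add: frac_def)
  have *: "frac (t - c) = (if u < c then u - c + 1 else u - c)" if "0 \<le> c" "c \<le> 1" for c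
    using that u(1,2) by (subst u(3)) (auto simp: frac_unique_iff)
  show ?thesis using assms *[of a] *[of b] by (auto simp: indicator_def simp flip: u_def)
qed

text \<open>Both claims follow from the expression through sawtooths; in the integral the two
  shifted sawtooths cancel by translation invariance.\<close>

lemma trig_sandwiched_indicator:
  fixes a b :: real
  assumes "0 \<le> a" "a \<le> b" "b \<le> 1"
  shows "trig_sandwiched (\<lambda>t. of_real (indicator {a..<b} (frac t)))"
    and "integral {0..1} (\<lambda>t. complex_of_real (indicator {a..<b} (frac t))) = of_real (b - a)"
proof -
  have eq: "complex_of_real (indicator {a..<b} (frac t))
      = of_real (b - a) + of_real (frac (t - b)) - of_real (frac (t - a))" for t
    by (simp add: indicator_frac[OF assms])
  note trig_sandwiched = trig_sandwiched_const trig_sandwiched_shift[OF trig_sandwiched_frac]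
  show "trig_sandwiched (\<lambda>t. of_real (indicator {a..<b} (frac t)))"
    unfolding eq by (intro trig_sandwiched_diff trig_sandwiched_add trig_sandwiched)
  have "integral {0..1} (\<lambda>t. complex_of_real (b - a) + of_real (frac (t - b)) - of_real (frac (t - a)))
      = of_real (b - a) + integral {0..1} (\<lambda>t. of_real (frac (t - b))) - integral {0..1} (\<lambda>t. of_real (frac (t - a)))"
    by (simp add: integral_diff integral_add trig_sandwiched_integrable trig_sandwiched_add trig_sandwiched)
  then show "integral {0..1} (\<lambda>t. complex_of_real (indicator {a..<b} (frac t))) = of_real (b - a)"
    unfolding eq by (simp add: trig_sandwiched_integral_shift[OF trig_sandwiched_frac])
qed

text \<open>The lower Darboux step function serves as centre and the oscillation step function as
  error; the integral of the latter is exactly the Darboux difference in the definition.\<close>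

lemma riemann_int01_trig_sandwiched:
  assumes "riemann_int01 f" shows "trig_sandwiched (\<lambda>t. of_real (f (frac t)))"
proof (rule trig_sandwiched_approx)
  fix e :: real assume "e > 0"
  obtain n :: nat and x :: "nat \<Rightarrow> real" where x: "x 0 = 0" "x n = 1" "\<And>k. k < n \<Longrightarrow> x k < x (Suc k)"
    and osc: "(\<Sum>k<n. (Sup (f ` {x k..<x (Suc k)}) - Inf (f ` {x k..<x (Suc k)})) * (x (Suc k) - x k)) < e"
    using assms \<open>e > 0\<close> unfolding riemann_int01_def by blast
  have mono: "x i \<le> x j" if "i \<le> j" "j \<le> n" for i j
    using that
  proof (induction j rule: dec_induct)
    case (step j)
    then show ?case using x(3)[of j] by simp
  qed simp
  have range: "0 \<le> x k" "x k \<le> x (Suc k)" "x (Suc k) \<le> 1" if "k < n" for k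
    using mono[of 0 k] mono[of k "Suc k"] mono[of "Suc k" n] that x by auto
  define step :: "(nat \<Rightarrow> real) \<Rightarrow> real \<Rightarrow> complex"
    where "step c t = (\<Sum>k<n. of_real (c k) * of_real (indicator {x k..<x (Suc k)} (frac t)))" for c t
  have step_trig_sandwiched: "trig_sandwiched (step c)" for c
    unfolding step_def using range by (intro trig_sandwiched_sum trig_sandwiched_cmult trig_sandwiched_indicator) auto
  have step_integral: "integral {0..1} (step c) = of_real (\<Sum>k<n. c k * (x (Suc k) - x k))" for c
  proof -
    have "integral {0..1} (step c)
        = (\<Sum>k<n. of_real (c k) * integral {0..1} (\<lambda>t. complex_of_real (indicator {x k..<x (Suc k)} (frac t))))"
      unfolding step_def using range
      by (subst integral_sum) (auto intro!: trig_sandwiched_integrable trig_sandwiched_cmult trig_sandwiched_indicator)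
    then show ?thesis using range by (simp add: trig_sandwiched_indicator(2))
  qed
  define Lo Hi where "Lo k = Inf (f ` {x k..<x (Suc k)})" and "Hi k = Sup (f ` {x k..<x (Suc k)})" for k
  have osc_integral: "Re (integral {0..1} (step (\<lambda>k. Hi k - Lo k))) < e"
    using osc by (simp add: step_integral Lo_def Hi_def)
  have "cmod (of_real (f (frac t)) - step Lo t) \<le> Re (step (\<lambda>k. Hi k - Lo k) t)" for t
  proof -
    \<comment> \<open>Locates the partition cell that contains \<open>frac t\<close>.\<close>
    have "\<exists>k<j. x k \<le> frac t \<and> frac t < x (Suc k)" if "j \<le> n" "frac t < x j" for j
      using that
    proof (induction j)
      case 0
      then show ?case using x(1) frac_ge_0[of t] by simp
    next
      case (Suc j)
      then show ?case by (cases "frac t < x j") (auto intro: less_SucI)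
    qed
    then obtain k where k: "k < n" "x k \<le> frac t" "frac t < x (Suc k)"
      using x(2) frac_lt_1[of t] by force
    have "complex_of_real (indicator {x i..<x (Suc i)} (frac t)) = (if i = k then 1 else 0)" if "i < n" for i
      using k mono[of "Suc i" k] mono[of "Suc k" i] that
      by (cases i k rule: linorder_cases) (auto simp: indicator_def)
    then have step: "step c t = of_real (c k)" for c
      unfolding step_def using k(1) by (simp add: if_distrib[of "(*) _"] cong: if_cong)
    have sub: "{x k..<x (Suc k)} \<subseteq> {0..<1}" using range[OF k(1)] by auto
    \<comment> \<open>Boundedness on the cell is what makes \<open>Inf\<close> and
      \<open>Sup\<close> genuine lower and upper bounds of the values of \<open>f\<close>
      there.\<close>
    have "bounded (f ` {x k..<x (Suc k)})"
      using assms bounded_subset[OF _ image_mono[OF sub]] unfolding riemann_int01_def by blast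
    then have "bdd_above (f ` {x k..<x (Suc k)})" "bdd_below (f ` {x k..<x (Suc k)})"
      by (auto intro: bounded_imp_bdd_above bounded_imp_bdd_below)
    then have "Lo k \<le> f (frac t)" "f (frac t) \<le> Hi k"
      unfolding Lo_def Hi_def using k by (auto intro!: cInf_lower cSup_upper)
    then show ?thesis unfolding step by (simp flip: of_real_diff)
  qed
  then show "\<exists>G W. trig_sandwiched G \<and> trig_sandwiched W \<and> (\<forall>t. cmod (of_real (f (frac t)) - G t) \<le> Re (W t))
      \<and> Re (integral {0..1} W) < e"
    using step_trig_sandwiched osc_integral by blast
qed

text \<open>Projecting an approximant onto the disc containing the values of \<open>F\<close> does not increase its
  distance to \<open>F\<close>, so the approximants may be taken uniformly bounded.\<close>

lemma trig_sandwiched_bounded_approx: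
  assumes "trig_sandwiched F" "e > 0" "\<And>t. F (frac t) = F t" "\<And>t. cmod (F t) \<le> B"
  obtains S P S' Q where "trig_poly S P" "trig_poly S' Q" "\<And>t. cmod (F t - P t) \<le> Re (Q t)"
    "Re (integral {0..1} Q) < e" "\<And>t. cmod (P t) \<le> B + 1"
proof -
  \<comment> \<open>The cap 1 keeps the new approximant within \<open>B + 1\<close>; the cap
    \<open>e / 2\<close> pays for the constant added to \<open>Q\<close>.\<close>
  define d where "d = min 1 (e / 2)"
  have d: "d > 0" "d \<le> 1" "d \<le> e / 2" using assms(2) by (auto simp: d_def)
  obtain S P S' Q where PQ: "trig_poly S P" "trig_poly S' Q" "\<And>t. cmod (F t - P t) \<le> Re (Q t)"
    "Re (integral {0..1} Q) < e / 2"
    using trig_sandwichedE[OF assms(1) half_gt_zero[OF assms(2)]] by blast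
  have B: "B \<ge> 0" using assms(4)[of 0] norm_ge_zero order_trans by blast
  define h where "h t = closest_point (cball 0 B) (P t)" for t
  have contr: "dist (closest_point (cball 0 B) z) (closest_point (cball 0 B) w) \<le> dist z w" for z w :: complex
    using B by (intro closest_point_lipschitz) auto
  have "continuous_on {0..1} h"
    unfolding h_def using B
    by (auto intro!: continuous_on_compose2[OF continuous_on_closest_point[of "cball 0 B" UNIV] trig_poly_continuous[OF PQ(1)]])
  moreover have "h 0 = h 1"
    unfolding h_def using trig_poly_frac[OF PQ(1), of 1] by simp
  \<comment> \<open>The projected function \<open>h\<close> is in general no longer a trigonometric
    polynomial, but it is a continuous loop and so is uniformly close to one.\<close>
  ultimately obtain T R where TR: "trig_poly T R" "\<And>t. cmod (h (frac t) - R t) < d"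
    using loop_approx[OF _ _ d(1)] by metis
  have h_frac: "h (frac t) = h t" for t
    unfolding h_def by (simp add: trig_poly_frac[OF PQ(1)])
  have hB: "cmod (h t) \<le> B" for t
    using closest_point_in_set[of "cball 0 B" "P t"] B unfolding h_def by simp
  have "cmod (F t - h t) \<le> cmod (F t - P t)" for t
    using contr[of "F t" "P t"] assms(4)[of t] closest_point_self[of "F t" "cball 0 B"]
    by (simp add: h_def dist_norm)
  then have "cmod (F t - R t) \<le> Re (Q t + of_real d)" for t
    using norm_triangle_ineq[of "F t - h t" "h t - R t"] PQ(3)[of t] TR(2)[of t]
    by (simp add: h_frac) (smt (verit))
  moreover have "cmod (R t) \<le> B + 1" for t
    using norm_triangle_ineq4[of "h t" "h t - R t"] hB[of t] TR(2)[of t] d(2) by (simp add: h_frac)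
  moreover have "Re (integral {0..1} (\<lambda>t. Q t + of_real d)) < e"
    using PQ(4) d(3) by (simp add: integral_add trig_poly_integrable[OF PQ(2)] trig_poly_integrable[OF trig_poly_const])
  ultimately show ?thesis
    using that TR(1) trig_poly_add[OF PQ(2) trig_poly_const] by blast
qed

section \<open>The correlation function and its Fourier series\<close>

text \<open>One function serves both sides of the diffraction formula: for the periodic extension of
  \<open>f\<close> its value at \<open>z * \<alpha>\<close> is \<open>Xi f \<alpha> z\<close>, and
  for the lift of \<open>l\<close> it is the lift of \<open>conv_tilde l\<close>.\<close>

definition corr :: "(real \<Rightarrow> complex) \<Rightarrow> real \<Rightarrow> complex" where
  "corr F s = integral {0..1} (\<lambda>t. F t * cnj (F (t - s)))"

definition fcoeff :: "(real \<Rightarrow> complex) \<Rightarrow> int \<Rightarrow> complex" where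
  "fcoeff F m = integral {0..1} (\<lambda>t. F t * chr (- m) t)"

definition fpart :: "(real \<Rightarrow> complex) \<Rightarrow> int set \<Rightarrow> real \<Rightarrow> complex" where
  "fpart F S t = (\<Sum>m\<in>S. fcoeff F m * chr m t)"

lemma trig_sandwiched_chr: "trig_sandwiched (chr m)"
  using trig_poly_trig_sandwiched[OF trig_poly_chr[of m 1]] by simp

lemma trig_sandwiched_fpart: "trig_sandwiched (fpart F S)"
  unfolding fpart_def by (intro trig_sandwiched_sum trig_sandwiched_cmult trig_sandwiched_chr)

lemma corr_integrable: "trig_sandwiched F \<Longrightarrow> (\<lambda>t. F t * cnj (F (t - s))) integrable_on {0..1}"
  by (intro trig_sandwiched_integrable trig_sandwiched_mult trig_sandwiched_cnj trig_sandwiched_shift)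

lemma fcoeff_diff: "trig_sandwiched F \<Longrightarrow> trig_sandwiched G \<Longrightarrow> fcoeff (\<lambda>t. F t - G t) m = fcoeff F m - fcoeff G m"
  unfolding fcoeff_def
  by (simp add: left_diff_distrib integral_diff trig_sandwiched_integrable trig_sandwiched_mult trig_sandwiched_chr)

lemma fcoeff_trig:
  assumes "finite S"
  shows "fcoeff (\<lambda>t. \<Sum>m\<in>S. c m * chr m t) k = (if k \<in> S then c k else 0)"
proof -
  have "(\<lambda>t. (\<Sum>m\<in>S. c m * chr m t) * chr (- k) t) = (\<lambda>t. \<Sum>m\<in>S. c m * chr (m - k) t)"
    by (simp add: sum_distrib_right mult.assoc chr_mult)
  moreover have "((\<lambda>t. \<Sum>m\<in>S. c m * chr (m - k) t) has_integral
      (\<Sum>m\<in>S. c m * (if m - k = 0 then 1 else 0))) {0..1}"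
    by (intro has_integral_sum has_integral_mult_right has_integral_chr assms)
  moreover have "(\<Sum>m\<in>S. c m * (if m - k = 0 then 1 else 0)) = (if k \<in> S then c k else 0)"
    using assms by (simp add: if_distrib[of "(*) _"] cong: if_cong)
  ultimately show ?thesis
    unfolding fcoeff_def by (simp only: integral_unique)
qed

section \<open>Parseval's identity in shifted form\<close>

text \<open>The function \<open>G\<close> is kept apart from \<open>F\<close> so that the lemma
  covers both the cross term, with \<open>G = F\<close>, and the square term, with
  \<open>G = fpart F S\<close>.\<close>

lemma integral_mult_cnj_fpart:
  assumes "finite S" "trig_sandwiched G"
  shows "integral {0..1} (\<lambda>t. G t * cnj (fpart F S (t - s)))
     = (\<Sum>m\<in>S. cnj (fcoeff F m) * fcoeff G m * chr m s)"
proof -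
  have "integral {0..1} (\<lambda>t. G t * cnj (fpart F S (t - s)))
      = integral {0..1} (\<lambda>t. \<Sum>m\<in>S. (cnj (fcoeff F m) * chr m s) * (G t * chr (- m) t))"
    by (simp add: fpart_def cnj_chr chr_diff sum_distrib_left mult_ac)
  also have "\<dots> = (\<Sum>m\<in>S. (cnj (fcoeff F m) * chr m s) * fcoeff G m)"
    unfolding fcoeff_def using assms
    by (subst integral_sum) (auto intro!: trig_sandwiched_integrable trig_sandwiched_cmult trig_sandwiched_mult trig_sandwiched_chr)
  finally show ?thesis by (simp add: mult_ac)
qed

lemma integral_fpart_mult_cnj:
  assumes "finite S" "trig_sandwiched F"
  shows "integral {0..1} (\<lambda>t. fpart F S t * cnj (F (t - s)))
     = (\<Sum>m\<in>S. cnj (fcoeff F m) * fcoeff F m * chr m s)"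
proof -
  have *: "integral {0..1} (\<lambda>t. chr m t * cnj (F (t - s))) = chr m s * cnj (fcoeff F m)" for m
  proof -
    \<comment> \<open>Splitting off \<open>chr m s\<close> makes the rest a function of
      \<open>t - s\<close>, so translation invariance removes the shift.\<close>
    have "chr m t * cnj (F (t - s)) = chr m s * (chr m (t - s) * cnj (F (t - s)))" for t
      using chr_add[of m "t - s" s] by (simp add: mult_ac)
    then have "integral {0..1} (\<lambda>t. chr m t * cnj (F (t - s)))
        = chr m s * integral {0..1} (\<lambda>t. chr m (t - s) * cnj (F (t - s)))"
      by (simp only: integral_mult_right)
    also have "integral {0..1} (\<lambda>t. chr m (t - s) * cnj (F (t - s))) = integral {0..1} (\<lambda>t. chr m t * cnj (F t))"
      by (rule trig_sandwiched_integral_shift) (intro trig_sandwiched_mult trig_sandwiched_chr trig_sandwiched_cnj assms)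
    also have "\<dots> = cnj (fcoeff F m)"
      using integral_cnj[of "{0..1}" "\<lambda>t. F t * chr (- m) t"] by (simp add: fcoeff_def cnj_chr mult.commute[of _ "chr m _"] mult.commute[of _ "chr (- m) _"])
    finally show ?thesis .
  qed
  have "integral {0..1} (\<lambda>t. fpart F S t * cnj (F (t - s))) = integral {0..1} (\<lambda>t. \<Sum>m\<in>S. fcoeff F m * (chr m t * cnj (F (t - s))))"
    by (simp add: fpart_def sum_distrib_right mult.assoc)
  also have "\<dots> = (\<Sum>m\<in>S. fcoeff F m * (chr m s * cnj (fcoeff F m)))"
    using assms by (subst integral_sum) (auto intro!: trig_sandwiched_integrable trig_sandwiched_cmult trig_sandwiched_mult trig_sandwiched_chr trig_sandwiched_cnj trig_sandwiched_shift simp: *)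
  finally show ?thesis by (simp add: mult_ac)
qed

text \<open>Expanding the product gives \<open>corr F s\<close> and three integrals involving the
  partial sum. All three equal the same finite sum and enter with signs -, -, +, so it is subtracted
  once.\<close>

lemma corr_diff_fpart:
  assumes "finite S" "trig_sandwiched F"
  shows "corr (\<lambda>t. F t - fpart F S t) s = corr F s - (\<Sum>m\<in>S. of_real ((cmod (fcoeff F m))\<^sup>2) * chr m s)"
proof -
  let ?P = "fpart F S"
  have fp: "fcoeff ?P m = fcoeff F m" if "m \<in> S" for m
    using fcoeff_trig[OF assms(1), of "fcoeff F" m] that by (simp add: fpart_def[abs_def])
  have "integral {0..1} (\<lambda>t. (F t - ?P t) * cnj (F (t - s) - ?P (t - s)))
    = integral {0..1} (\<lambda>t. F t * cnj (F (t - s)) - ?P t * cnj (F (t - s)) - (F t * cnj (?P (t - s)) - ?P t * cnj (?P (t - s))))"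
    by (simp add: algebra_simps)
  also have "\<dots> = integral {0..1} (\<lambda>t. F t * cnj (F (t - s)))
      - integral {0..1} (\<lambda>t. ?P t * cnj (F (t - s)))
      - (integral {0..1} (\<lambda>t. F t * cnj (?P (t - s))) - integral {0..1} (\<lambda>t. ?P t * cnj (?P (t - s))))"
    by (subst integral_diff; (intro trig_sandwiched_integrable trig_sandwiched_diff trig_sandwiched_mult trig_sandwiched_cnj trig_sandwiched_shift trig_sandwiched_fpart assms)?)+ simp
  finally show ?thesis
    unfolding corr_def integral_fpart_mult_cnj[OF assms] integral_mult_cnj_fpart[OF assms]
      integral_mult_cnj_fpart[OF assms(1) trig_sandwiched_fpart]
    by (simp add: fp complex_norm_square mult_ac del: of_real_power)
qed

text \<open>The bound \<open>2 * a * b \<le> a * a + b * b\<close> and translation invariance reduce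
  every shift to the squared L2 norm at shift 0. This makes the later estimates uniform in
  \<open>s\<close>.\<close>

lemma norm_corr_le:
  assumes "trig_sandwiched F" shows "cmod (corr F s) \<le> Re (corr F 0)"
proof -
  let ?W = "\<lambda>t. F t * cnj (F t)"
  have W: "trig_sandwiched ?W" by (intro trig_sandwiched_mult trig_sandwiched_cnj assms)
  have "cmod (corr F s) \<le> Re (integral {0..1} (\<lambda>t. (1 / 2) * (?W t + ?W (t - s))))"
    unfolding corr_def
  proof (rule cmod_integral_le[OF corr_integrable[OF assms]])
    show "(\<lambda>t. (1 / 2) * (?W t + ?W (t - s))) integrable_on {0..1}"
      by (intro trig_sandwiched_integrable trig_sandwiched_cmult trig_sandwiched_add W trig_sandwiched_shift[OF W])
    fix t
    show "cmod (F t * cnj (F (t - s))) \<le> Re ((1 / 2) * (?W t + ?W (t - s)))"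
      using sum_squares_bound[of "cmod (F t)" "cmod (F (t - s))"]
      by (simp add: norm_mult complex_norm_square[symmetric] del: of_real_power)
  qed
  also have "integral {0..1} (\<lambda>t. (1 / 2) * (?W t + ?W (t - s)))
      = (1 / 2) * (integral {0..1} ?W + integral {0..1} (\<lambda>t. ?W (t - s)))"
    using trig_sandwiched_integrable[OF W] trig_sandwiched_integrable[OF trig_sandwiched_shift[OF W]] by (simp add: integral_add)
  also have "\<dots> = integral {0..1} ?W"
    by (simp add: trig_sandwiched_integral_shift[OF W])
  finally show ?thesis by (simp add: corr_def)
qed

text \<open>L1 closeness becomes L2 closeness because the approximants are uniformly bounded:
  \<open>F - P\<close> is at most \<open>B + (B + 1) = M\<close> in modulus, so its square is at
  most \<open>M\<close> times the L1 error.\<close>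

lemma trig_sandwiched_square_approx:
  assumes "trig_sandwiched F" "\<And>t. F (frac t) = F t" "e > 0"
  obtains S P where "trig_poly S P" "Re (corr (\<lambda>t. F t - P t) 0) < e"
proof -
  obtain B where B: "B > 0" "\<And>t. cmod (F t) \<le> B" using trig_sandwiched_bounded[OF assms(1)] by blast
  define M where "M = 2 * B + 1"
  have M: "M > 0" using B(1) by (simp add: M_def)
  then have "e / M > 0" using assms(3) by simp
  then obtain S P S' Q where PQ: "trig_poly S P" "trig_poly S' Q" "\<And>t. cmod (F t - P t) \<le> Re (Q t)"
    "Re (integral {0..1} Q) < e / M" "\<And>t. cmod (P t) \<le> B + 1"
    using trig_sandwiched_bounded_approx[OF assms(1) _ assms(2) B(2)] by blast
  have "cmod (corr (\<lambda>t. F t - P t) 0) \<le> Re (integral {0..1} (\<lambda>t. of_real M * Q t))"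
    unfolding corr_def
  proof (rule cmod_integral_le)
    show "(\<lambda>t. (F t - P t) * cnj (F (t - 0) - P (t - 0))) integrable_on {0..1}"
      by (intro corr_integrable[of "\<lambda>t. F t - P t"] trig_sandwiched_diff assms trig_poly_trig_sandwiched[OF PQ(1)])
    show "(\<lambda>t. of_real M * Q t) integrable_on {0..1}"
      by (rule trig_poly_integrable[OF trig_poly_cmult[OF PQ(2)]])
    fix t
    have "cmod (F t - P t) \<le> M"
      using norm_triangle_ineq4[of "F t" "P t"] B(2)[of t] PQ(5)[of t] by (simp add: M_def)
    then have "cmod (F t - P t) * cmod (F t - P t) \<le> M * Re (Q t)"
      using PQ(3)[of t] M by (intro mult_mono) auto
    then show "cmod ((F t - P t) * cnj (F (t - 0) - P (t - 0))) \<le> Re (of_real M * Q t)"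
      by (simp add: norm_mult del: complex_cnj_diff)
  qed
  also have "\<dots> < e" using PQ(4) M by (simp add: field_simps)
  finally show ?thesis using that PQ(1) complex_Re_le_cmod le_less_trans by blast
qed

text \<open>Bessel's inequality with a trigonometric approximant \<open>P\<close>: once
  \<open>S\<close> contains the frequencies of \<open>P\<close>, the remainder of \<open>F\<close>
  equals the remainder of \<open>F - P\<close>, whose norm is at most that of \<open>F - P\<close>.
  The finite set \<open>X\<close> does not depend on \<open>s\<close>.\<close>

lemma corr_fpart_bound:
  assumes "trig_sandwiched F" "\<And>t. F (frac t) = F t" "e > 0"
  obtains X where "finite X" "\<And>S s. finite S \<Longrightarrow> X \<subseteq> S \<Longrightarrow>
     cmod (corr F s - (\<Sum>m\<in>S. of_real ((cmod (fcoeff F m))\<^sup>2) * chr m s)) < e"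
proof -
  obtain X P where P: "trig_poly X P" and Pe: "Re (corr (\<lambda>t. F t - P t) 0) < e"
    using trig_sandwiched_square_approx[OF assms] by blast
  have finX: "finite X" using P by (simp add: trig_poly_def)
  have "cmod (corr F s - (\<Sum>m\<in>S. of_real ((cmod (fcoeff F m))\<^sup>2) * chr m s)) < e"
    if S: "finite S" "X \<subseteq> S" for S s
  proof -
    obtain c where c: "P = (\<lambda>t. \<Sum>m\<in>S. c m * chr m t)"
      using trig_poly_mono[OF P S(2,1)] by (rule trig_polyE)
    have D: "trig_sandwiched (\<lambda>t. F t - P t)" by (intro trig_sandwiched_diff assms(1) trig_poly_trig_sandwiched[OF P])
    have "fpart (\<lambda>t. F t - P t) S t = fpart F S t - P t" for t
    proof -
      have "fcoeff (\<lambda>t. F t - P t) m = fcoeff F m - c m" if "m \<in> S" for m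
        using that fcoeff_diff[OF assms(1) trig_poly_trig_sandwiched[OF P], of m] fcoeff_trig[OF S(1), of c m]
        by (simp add: c)
      then show ?thesis by (simp add: fpart_def c left_diff_distrib sum_subtractf)
    qed
    then have eq: "(\<lambda>t. (F t - P t) - fpart (\<lambda>t. F t - P t) S t) = (\<lambda>t. F t - fpart F S t)"
      by simp
    have "cmod (corr (\<lambda>t. F t - fpart F S t) s) \<le> Re (corr (\<lambda>t. F t - fpart F S t) 0)"
      by (intro norm_corr_le trig_sandwiched_diff assms trig_sandwiched_fpart)
    also have "\<dots> = Re (corr (\<lambda>t. F t - P t) 0) - (\<Sum>m\<in>S. (cmod (fcoeff (\<lambda>t. F t - P t) m))\<^sup>2)"
      using corr_diff_fpart[OF S(1) D, of 0] unfolding eq by simp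
    also have "\<dots> \<le> Re (corr (\<lambda>t. F t - P t) 0)"
      by (simp add: sum_nonneg)
    finally show ?thesis using Pe corr_diff_fpart[OF S(1) assms(1), of s] by simp
  qed
  then show ?thesis using that finX by blast
qed

theorem corr_has_sum:
  assumes "trig_sandwiched F" "\<And>t. F (frac t) = F t"
  shows "((\<lambda>m. of_real ((cmod (fcoeff F m))\<^sup>2) * chr m s) has_sum corr F s) UNIV"
  unfolding has_sum_def tendsto_iff eventually_finite_subsets_at_top
proof (intro allI impI)
  fix e :: real assume "e > 0"
  then obtain X where "finite X" "\<And>S s. finite S \<Longrightarrow> X \<subseteq> S \<Longrightarrow>
     cmod (corr F s - (\<Sum>m\<in>S. of_real ((cmod (fcoeff F m))\<^sup>2) * chr m s)) < e"
    using corr_fpart_bound[OF assms] by metis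
  then show "\<exists>X. finite X \<and> X \<subseteq> UNIV \<and> (\<forall>Y. finite Y \<and> X \<subseteq> Y \<and> Y \<subseteq> UNIV \<longrightarrow>
      dist (\<Sum>m\<in>Y. of_real ((cmod (fcoeff F m))\<^sup>2) * chr m s) (corr F s) < e)"
    by (intro exI[of _ X]) (auto simp: dist_norm norm_minus_commute)
qed

lemma fcoeff_square_summable:
  assumes "trig_sandwiched F" "\<And>t. F (frac t) = F t"
  shows "(\<lambda>m. (cmod (fcoeff F m))\<^sup>2) summable_on UNIV"
proof -
  have "((\<lambda>m. Re (of_real ((cmod (fcoeff F m))\<^sup>2) * chr m 0)) has_sum Re (corr F 0)) UNIV"
    by (rule has_sum_bounded_linear[OF bounded_linear_Re corr_has_sum[OF assms], unfolded o_def])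
  then show ?thesis by (auto simp: summable_on_def simp del: of_real_power)
qed

text \<open>Although \<open>F\<close> may jump, its correlation is a uniform limit of trigonometric
  polynomials.\<close>

lemma corr_continuous:
  assumes "trig_sandwiched F" "\<And>t. F (frac t) = F t"
  shows "continuous_on UNIV (corr F)"
proof (rule uniform_limit_theorem[where F = "finite_subsets_at_top UNIV"])
  show "\<forall>\<^sub>F S in finite_subsets_at_top UNIV. continuous_on UNIV
      (\<lambda>s. \<Sum>m\<in>S. of_real ((cmod (fcoeff F m))\<^sup>2) * chr m s)"
    by (intro always_eventually allI continuous_intros)
  show "uniform_limit UNIV (\<lambda>S s. \<Sum>m\<in>S. of_real ((cmod (fcoeff F m))\<^sup>2) * chr m s) (corr F)
      (finite_subsets_at_top UNIV)"
    unfolding uniform_limit_iff eventually_finite_subsets_at_top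
  proof (intro allI impI)
    fix e :: real assume "e > 0"
    then obtain X where "finite X" "\<And>S s. finite S \<Longrightarrow> X \<subseteq> S \<Longrightarrow>
       cmod (corr F s - (\<Sum>m\<in>S. of_real ((cmod (fcoeff F m))\<^sup>2) * chr m s)) < e"
      using corr_fpart_bound[OF assms] by metis
    then show "\<exists>X. finite X \<and> X \<subseteq> UNIV \<and> (\<forall>Y. finite Y \<and> X \<subseteq> Y \<and> Y \<subseteq> UNIV \<longrightarrow>
        (\<forall>s\<in>UNIV. dist (\<Sum>m\<in>Y. of_real ((cmod (fcoeff F m))\<^sup>2) * chr m s) (corr F s) < e))"
      by (intro exI[of _ X]) (auto simp: dist_norm norm_minus_commute)
  qed
qed simp

section \<open>Averages along orbits\<close>

definition avg :: "nat \<Rightarrow> (int \<Rightarrow> 'a::real_normed_field) \<Rightarrow> 'a" where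
  "avg n u = (\<Sum>x\<in>{- int n..int n}. u x) / of_nat (2 * n + 1)"

lemma avg_diff: "avg n (\<lambda>x. u x - v x) = avg n u - avg n v"
  unfolding avg_def sum_subtractf diff_divide_distrib ..

lemma avg_cmult: "avg n (\<lambda>x. a * u x) = a * avg n u"
  unfolding avg_def sum_distrib_left[symmetric] by simp

lemma avg_sum: "avg n (\<lambda>x. \<Sum>i\<in>A. u i x) = (\<Sum>i\<in>A. avg n (u i))"
  unfolding avg_def sum_divide_distrib[symmetric] by (subst sum.swap) simp

lemma avg_const [simp]: "avg n (\<lambda>_. a) = a"
proof -
  have "nat (1 + int n + int n) = 2 * n + 1" by simp
  moreover have "(of_nat (2 * n + 1) :: 'a) \<noteq> 0" using of_nat_neq_0[of "2 * n"] by simp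
  ultimately show ?thesis by (simp add: avg_def)
qed

lemma norm_avg_le:
  fixes u :: "int \<Rightarrow> complex"
  assumes "\<And>x. cmod (u x) \<le> Re (v x)"
  shows "cmod (avg n u) \<le> Re (avg n v)"
proof -
  have "cmod (\<Sum>x\<in>{- int n..int n}. u x) \<le> (\<Sum>x\<in>{- int n..int n}. Re (v x))"
    using assms by (rule sum_norm_le)
  then show ?thesis
    by (simp add: avg_def norm_divide Re_divide_of_nat divide_right_mono del: of_nat_add of_nat_mult of_nat_Suc)
qed

lemma avg_tendsto_0:
  fixes u :: "int \<Rightarrow> complex"
  assumes "\<And>n. cmod (\<Sum>x\<in>{- int n..int n}. u x) \<le> B"
  shows "(\<lambda>n. avg n u) \<longlonglongrightarrow> 0"
proof (rule Lim_null_comparison)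
  show "\<forall>\<^sub>F n in sequentially. cmod (avg n u) \<le> B / real (2 * n + 1)"
    using assms
    by (intro always_eventually allI)
       (simp add: avg_def norm_divide divide_right_mono del: of_nat_add of_nat_mult of_nat_Suc)
  have "filterlim (\<lambda>n. 2 * n + 1 :: nat) at_top sequentially"
    by (rule filterlim_subseq) (simp add: strict_mono_def)
  then have "filterlim (\<lambda>n. real (2 * n + 1)) at_top sequentially"
    by (rule filterlim_compose[OF filterlim_real_sequentially])
  then show "(\<lambda>n. B / real (2 * n + 1)) \<longlonglongrightarrow> 0"
    by (intro tendsto_divide_0[OF tendsto_const] filterlim_at_top_imp_at_infinity)
qed

lemma avg_chr:
  assumes "of_int m * \<beta> \<notin> \<int>"
  shows "(\<lambda>n. avg n (\<lambda>x. chr m (y + of_int x * \<beta>))) \<longlonglongrightarrow> 0"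
proof -
  define q where "q = chr m \<beta>"
  have q1: "q \<noteq> 1" using assms chr_eq_1_iff q_def by auto
  define v where "v x = chr m (y + of_int x * \<beta>)" for x :: int
  have v1: "v (x + 1) = q * v x" for x
    by (simp add: v_def q_def chr_def cis_mult algebra_simps)
  \<comment> \<open>Multiplying the geometric sum by \<open>q - 1\<close> leaves two boundary terms
    of modulus 1, so the sums are bounded independently of \<open>n\<close>.\<close>
  have tele: "(q - 1) * (\<Sum>x\<in>{- int n..int n}. v x) = v (int n + 1) - v (- int n)" for n
  proof (induction n)
    case 0
    then show ?case using v1[of 0] by (simp add: algebra_simps)
  next
    case (Suc n)
    have "{- int (Suc n)..int (Suc n)} = insert (int n + 1) (insert (- 1 - int n) {- int n..int n})"
      by auto
    then have "(\<Sum>x\<in>{- int (Suc n)..int (Suc n)}. v x)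
        = v (int n + 1) + (v (- 1 - int n) + (\<Sum>x\<in>{- int n..int n}. v x))"
      by simp
    then show ?case
      using Suc v1[of "int n + 1"] v1[of "- 1 - int n"] by (simp add: algebra_simps)
  qed
  have "cmod (\<Sum>x\<in>{- int n..int n}. v x) \<le> 2 / cmod (q - 1)" for n
  proof -
    have "cmod (q - 1) * cmod (\<Sum>x\<in>{- int n..int n}. v x) \<le> 2"
      using norm_triangle_ineq4[of "v (int n + 1)" "v (- int n)"]
      unfolding norm_mult[symmetric] tele by (simp add: v_def)
    then show ?thesis using q1 by (simp add: field_simps)
  qed
  then show ?thesis unfolding v_def by (rule avg_tendsto_0)
qed

text \<open>Nonresonance is asked only of the finitely many frequencies in \<open>S\<close>, so a
  rational \<beta> qualifies as long as its denominator divides none of the nonzero ones.\<close>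

lemma avg_trig_poly:
  assumes "trig_poly S P" "\<And>m. m \<in> S - {0} \<Longrightarrow> of_int m * \<beta> \<notin> \<int>"
  shows "(\<lambda>n. avg n (\<lambda>x. P (y + of_int x * \<beta>))) \<longlonglongrightarrow> integral {0..1} P"
proof -
  obtain c where fin: "finite S" and c: "P = (\<lambda>t. \<Sum>m\<in>S. c m * chr m t)"
    using assms(1) by (rule trig_polyE)
  have "(\<lambda>n. avg n (\<lambda>x. chr m (y + of_int x * \<beta>))) \<longlonglongrightarrow> (if m = 0 then 1 else 0)"
    if "m \<in> S" for m
    using avg_chr[OF assms(2), of m y] that by auto
  then have "(\<lambda>n. \<Sum>m\<in>S. c m * avg n (\<lambda>x. chr m (y + of_int x * \<beta>)))
     \<longlonglongrightarrow> (\<Sum>m\<in>S. c m * (if m = 0 then 1 else 0))"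
    by (intro tendsto_sum tendsto_mult tendsto_const)
  moreover have "(\<Sum>m\<in>S. c m * (if m = 0 then 1 else 0)) = integral {0..1} P"
    using integral_unique[OF has_integral_trig_poly[OF fin, of c]] fin
    by (simp add: c if_distrib cong: if_cong)
  ultimately show ?thesis by (simp add: c avg_sum avg_cmult)
qed

lemma avg_of_real: "avg n (\<lambda>x. complex_of_real (u x)) = of_real (avg n u)"
  by (simp add: avg_def)

section \<open>Averages along periodic and equidistributed orbits\<close>

text \<open>Enlarging the window by \<open>q\<close> on each side adds a fixed amount
  \<open>E\<close>. After subtracting the mean the window sums are periodic in \<open>n\<close>,
  hence bounded, and their averages vanish in the limit.\<close>

lemma avg_periodic_convergent:
  fixes u :: "int \<Rightarrow> complex"
  assumes "q > 0" "\<And>x. u (x + int q) = u x"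
  shows "convergent (\<lambda>n. avg n u)"
proof -
  define S where "S n = (\<Sum>x\<in>{- int n..int n}. u x)" for n
  have S_Suc: "S (Suc n) = S n + u (int n + 1) + u (- int n - 1)" for n
  proof -
    have "{- int (Suc n)..int (Suc n)} = insert (int n + 1) (insert (- int n - 1) {- int n..int n})"
      by auto
    then show ?thesis by (simp add: S_def del: of_nat_Suc)
  qed
  define E where "E = S q - S 0"
  have E: "S (n + q) = S n + E" for n
  proof (induction n)
    case (Suc n)
    have "int (n + q) + 1 = int n + 1 + int q" "- int n - 1 = - int (n + q) - 1 + int q" by simp_all
    then have "u (int (n + q) + 1) = u (int n + 1)" "u (- int n - 1) = u (- int (n + q) - 1)"
      by (simp_all only: assms(2))
    then show ?case using Suc S_Suc[of "n + q"] S_Suc[of n] by simp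
  qed (simp add: E_def)
  \<comment> \<open>Passing from \<open>n\<close> to \<open>n + q\<close> adds \<open>2 * q\<close>
    terms, so \<open>c\<close> is the mean contribution per term.\<close>
  define c where "c = E / of_nat (2 * q)"
  define D where "D n = S n - of_nat (2 * n + 1) * c" for n
  have "D (n + q) = D n" for n
    using assms(1) by (simp add: D_def E c_def field_simps)
  note D_q = this
  have "D (k + j * q) = D k" for k j
  proof (induction j)
    case (Suc j)
    have "k + Suc j * q = (k + j * q) + q" by simp
    then show ?case using Suc by (simp only: D_q)
  qed simp
  from this[of "n mod q" "n div q" for n] have D_mod: "D n = D (n mod q)" for n
    by (metis mod_div_mult_eq)
  have "cmod (\<Sum>x\<in>{- int n..int n}. u x - c) \<le> (\<Sum>k<q. cmod (D k))" for n
  proof -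
    have "nat (1 + int n + int n) = 2 * n + 1" by simp
    then have "(\<Sum>x\<in>{- int n..int n}. u x - c) = D n"
      by (simp add: sum_subtractf D_def S_def)
    also have "cmod (D n) \<le> (\<Sum>k<q. cmod (D k))"
      unfolding D_mod[of n] using assms(1) by (intro member_le_sum) auto
    finally show ?thesis .
  qed
  then have "(\<lambda>n. avg n (\<lambda>x. u x - c)) \<longlonglongrightarrow> 0"
    by (rule avg_tendsto_0)
  then have "(\<lambda>n. avg n u) \<longlonglongrightarrow> c"
    by (simp add: avg_diff LIM_zero_iff)
  then show ?thesis by (rule convergentI)
qed

text \<open>Weyl equidistribution: irrationality of \<beta> is stated as the absence of resonances,
  so the averages of both the centre and the error converge to their integrals.\<close>

lemma avg_trig_sandwiched:
  assumes "trig_sandwiched F" "\<And>m::int. m \<noteq> 0 \<Longrightarrow> of_int m * \<beta> \<notin> \<int>"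
  shows "(\<lambda>n. avg n (\<lambda>x. F (y + of_int x * \<beta>))) \<longlonglongrightarrow> integral {0..1} F"
proof (rule tendstoI)
  fix e :: real assume "e > 0"
  then have "e / 4 > 0" by simp
  then obtain S P S' Q where PQ: "trig_poly S P" "trig_poly S' Q"
    "\<And>t. cmod (F t - P t) \<le> Re (Q t)" "Re (integral {0..1} Q) < e / 4"
    using trig_sandwichedE[OF assms(1)] by blast
  have P: "(\<lambda>n. avg n (\<lambda>x. P (y + of_int x * \<beta>))) \<longlonglongrightarrow> integral {0..1} P"
    using PQ(1) assms(2) by (intro avg_trig_poly) auto
  have "(\<lambda>n. avg n (\<lambda>x. Q (y + of_int x * \<beta>))) \<longlonglongrightarrow> integral {0..1} Q"
    using PQ(2) assms(2) by (intro avg_trig_poly) auto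
  then have Q: "(\<lambda>n. Re (avg n (\<lambda>x. Q (y + of_int x * \<beta>)))) \<longlonglongrightarrow> Re (integral {0..1} Q)"
    by (rule tendsto_Re)
  have FP: "cmod (integral {0..1} F - integral {0..1} P) < e / 4"
    using cmod_integral_le[of "\<lambda>t. F t - P t" Q] PQ(3,4) trig_sandwiched_integrable[OF assms(1)]
      trig_poly_integrable[OF PQ(1)] trig_poly_integrable[OF PQ(2)]
    by (simp add: integral_diff integrable_diff)
  show "\<forall>\<^sub>F n in sequentially. dist (avg n (\<lambda>x. F (y + of_int x * \<beta>))) (integral {0..1} F) < e"
    using tendstoD[OF P \<open>e / 4 > 0\<close>] order_tendstoD(2)[OF Q PQ(4)]
  proof eventually_elim
    case (elim n)
    have "cmod (avg n (\<lambda>x. F (y + of_int x * \<beta>)) - avg n (\<lambda>x. P (y + of_int x * \<beta>))) < e / 4"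
      using norm_avg_le[of "\<lambda>x. F (y + of_int x * \<beta>) - P (y + of_int x * \<beta>)"
          "\<lambda>x. Q (y + of_int x * \<beta>)" n] PQ(3) elim(2)
      unfolding avg_diff by (meson le_less_trans)
    then show ?case
      using elim(1) FP \<open>e > 0\<close>
        dist_triangle[of "avg n (\<lambda>x. F (y + of_int x * \<beta>))" "integral {0..1} F" "avg n (\<lambda>x. P (y + of_int x * \<beta>))"]
        dist_triangle[of "avg n (\<lambda>x. P (y + of_int x * \<beta>))" "integral {0..1} F" "integral {0..1} P"]
      by (simp add: dist_norm norm_minus_commute)
  qed
qed

section \<open>Limits of autocorrelations\<close>

text \<open>The integers other than \<open>m * \<alpha>\<close> form a closed set that misses the
  limit, so the sequence eventually avoids them. The value \<open>m * \<alpha>\<close> itself,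
  possibly an integer, is never attained since \<open>\<alpha>s i \<noteq> \<alpha>\<close>.\<close>

lemma eventually_not_Ints:
  fixes \<alpha>s :: "nat \<Rightarrow> real"
  assumes "\<alpha>s \<longlonglongrightarrow> \<alpha>" "\<forall>i. \<alpha>s i \<noteq> \<alpha>" "m \<noteq> 0"
  shows "\<forall>\<^sub>F i in sequentially. of_int m * \<alpha>s i \<notin> \<int>"
proof -
  have lim: "(\<lambda>i. of_int m * \<alpha>s i) \<longlonglongrightarrow> of_int m * \<alpha>"
    by (intro tendsto_intros assms)
  have "closed (\<int> - {of_int m * \<alpha>})"
    by (rule closed_subset_Ints) auto
  then have "\<forall>\<^sub>F i in sequentially. of_int m * \<alpha>s i \<in> - (\<int> - {of_int m * \<alpha>})"
    by (intro topological_tendstoD[OF lim] open_Compl) auto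
  then show ?thesis
    using assms by (auto elim!: eventually_mono)
qed

text \<open>For fixed \<open>S\<close>, all but finitely many \<open>\<alpha>s i\<close> admit no resonance with a nonzero frequency in \<open>S\<close>;
  for those, rational or not, averages along the orbit of trigonometric polynomials with frequencies in
  \<open>S\<close> converge to their integrals.\<close>

lemma autocorrelation_limit:
  fixes \<alpha>s :: "nat \<Rightarrow> real"
  assumes F: "trig_sandwiched F" "\<And>t. F (frac t) = F t"
    and \<alpha>: "\<alpha>s \<longlonglongrightarrow> \<alpha>" "\<forall>i. \<alpha>s i \<noteq> \<alpha>"
    and L: "\<And>i. (\<lambda>n. avg n (\<lambda>x. G i (ys i + of_int x * \<alpha>s i))) \<longlonglongrightarrow> L i"
    and bound: "\<And>i t. cmod (G i t - F t * cnj (F (t - of_int z * \<alpha>s i))) \<le> \<eta> i"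
    and \<eta>: "\<eta> \<longlonglongrightarrow> 0"
  shows "L \<longlonglongrightarrow> corr F (of_int z * \<alpha>)"
proof -
  define s where "s i = of_int z * \<alpha>s i" for i
  have "(\<lambda>i. L i - corr F (s i)) \<longlonglongrightarrow> 0"
  proof (rule tendstoI)
    fix e :: real assume "e > 0"
    obtain B where B: "B > 0" "\<And>t. cmod (F t) \<le> B" using trig_sandwiched_bounded[OF F(1)] by blast
    define M where "M = B + 1"
    have M: "M > 0" using B(1) by (simp add: M_def)
    \<comment> \<open>The error \<open>QQ\<close> consists of two shifted copies of
      \<open>M * Q\<close>, so this tolerance gives it an integral below
      \<open>e / 4\<close>.\<close>
    then have "e / (8 * M) > 0" using \<open>e > 0\<close> by simp
    then obtain S P S' Q where PQ: "trig_poly S P" "trig_poly S' Q" "\<And>t. cmod (F t - P t) \<le> Re (Q t)"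
      "Re (integral {0..1} Q) < e / (8 * M)" "\<And>t. cmod (P t) \<le> B + 1"
      using trig_sandwiched_bounded_approx[OF F(1) _ F(2) B(2)] by blast
    define PP where "PP i t = P t * cnj (P (t - s i))" for i t
    define QQ where "QQ i t = of_real M * Q t + of_real M * Q (t - s i)" for i t
    \<comment> \<open>Shifting by \<open>s i\<close> changes only coefficients, so this finite
      frequency set serves all \<open>i\<close> at once.\<close>
    define T where "T = (\<Union>m\<in>S. \<Union>k\<in>uminus ` S. {m + k})"
    have PP: "trig_poly T (PP i)" for i
      unfolding T_def PP_def by (intro trig_poly_mult trig_poly_cnj trig_poly_shift PQ)
    have QQ: "trig_poly (S' \<union> S') (QQ i)" for i
      unfolding QQ_def by (intro trig_poly_add trig_poly_cmult trig_poly_shift PQ)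
    \<comment> \<open>The constant \<open>\<eta> i\<close> contributes only frequency 0, which can
      never resonate.\<close>
    have QQ\<eta>: "trig_poly (S' \<union> S' \<union> {0}) (\<lambda>t. QQ i t + of_real (\<eta> i))" for i
      by (intro trig_poly_add QQ trig_poly_const)
    have QQ_int: "Re (integral {0..1} (QQ i)) < e / 4" for i
    proof -
      have "integral {0..1} (QQ i) = of_real M * integral {0..1} Q + of_real M * integral {0..1} (\<lambda>t. Q (t - s i))"
        unfolding QQ_def using trig_poly_integrable[OF PQ(2)] trig_poly_integrable[OF trig_poly_shift[OF PQ(2)]]
        by (simp add: integral_add integrable_on_mult_right)
      then show ?thesis
        using PQ(4) M unfolding trig_poly_integral_shift[OF PQ(2)] by (simp add: field_simps)
    qed
    have FFPP: "cmod (F t * cnj (F (t - s i)) - PP i t) \<le> Re (QQ i t)" for i t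
    proof -
      have "F t * cnj (F (t - s i)) - PP i t
          = cnj (F (t - s i)) * (F t - P t) + P t * cnj (F (t - s i) - P (t - s i))"
        by (simp add: PP_def algebra_simps)
      then have "cmod (F t * cnj (F (t - s i)) - PP i t)
          \<le> cmod (F (t - s i)) * cmod (F t - P t) + cmod (P t) * cmod (F (t - s i) - P (t - s i))"
        by (metis complex_mod_cnj norm_mult norm_triangle_ineq)
      also have "\<dots> \<le> M * Re (Q t) + M * Re (Q (t - s i))"
        using B(1) B(2)[of "t - s i"] PQ(5)[of t] PQ(3)[of t] PQ(3)[of "t - s i"]
        by (intro add_mono mult_mono) (auto simp: M_def)
      finally show ?thesis by (simp add: QQ_def)
    qed
    have corr_PP: "cmod (corr F (s i) - integral {0..1} (PP i)) \<le> Re (integral {0..1} (QQ i))" for i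
      using cmod_integral_le[OF integrable_diff[OF corr_integrable[OF F(1)] trig_poly_integrable[OF PP]]
          trig_poly_integrable[OF QQ] FFPP]
      unfolding corr_def
      by (simp add: integral_diff[OF corr_integrable[OF F(1)] trig_poly_integrable[OF PP]])
    have "\<forall>\<^sub>F i in sequentially. \<forall>m\<in>(T \<union> S') - {0}. of_int m * \<alpha>s i \<notin> \<int>"
      using PP QQ by (intro eventually_ball_finite ballI eventually_not_Ints[OF \<alpha>]) (auto simp: trig_poly_def)
    moreover have "\<forall>\<^sub>F i in sequentially. \<eta> i < e / 2"
      using \<eta> \<open>e > 0\<close> by (intro order_tendstoD) auto
    ultimately show "\<forall>\<^sub>F i in sequentially. dist (L i - corr F (s i)) 0 < e"
    proof eventually_elim
      case (elim i)
      \<comment> \<open>The limit in \<open>n\<close> is taken with \<open>i\<close> fixed, so a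
        bound on \<open>L i\<close> results; \<open>i\<close> varies only afterwards.\<close>
      have "(\<lambda>n. avg n (\<lambda>x. G i (ys i + of_int x * \<alpha>s i) - PP i (ys i + of_int x * \<alpha>s i)))
          \<longlonglongrightarrow> L i - integral {0..1} (PP i)"
        unfolding avg_diff using elim(1) by (intro tendsto_diff L avg_trig_poly[OF PP]) auto
      moreover have "(\<lambda>n. avg n (\<lambda>x. QQ i (ys i + of_int x * \<alpha>s i) + of_real (\<eta> i)))
          \<longlonglongrightarrow> integral {0..1} (\<lambda>t. QQ i t + of_real (\<eta> i))"
        using elim(1) by (intro avg_trig_poly[OF QQ\<eta>]) auto
      moreover have "cmod (G i t - PP i t) \<le> Re (QQ i t + of_real (\<eta> i))" for t
        using norm_triangle_ineq[of "G i t - F t * cnj (F (t - s i))" "F t * cnj (F (t - s i)) - PP i t"]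
          bound[of i t] FFPP[of t i] by (simp add: s_def)
      ultimately have "cmod (L i - integral {0..1} (PP i)) \<le> Re (integral {0..1} (\<lambda>t. QQ i t + of_real (\<eta> i)))"
        by (intro LIMSEQ_le[OF tendsto_norm tendsto_Re]) (auto intro!: norm_avg_le)
      also have "\<dots> < e / 4 + e / 2"
        using QQ_int[of i] elim(2)
        by (simp add: integral_add trig_poly_integrable[OF QQ] trig_poly_integrable[OF trig_poly_const])
      finally show ?case
        using corr_PP[of i] QQ_int[of i]
          norm_triangle_ineq4[of "L i - integral {0..1} (PP i)" "corr F (s i) - integral {0..1} (PP i)"]
        by simp
    qed
  qed
  \<comment> \<open>Up to here the shift was \<open>z * \<alpha>s i\<close>; continuity of the
    correlation replaces it by \<open>z * \<alpha>\<close>.\<close>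
  moreover have "(\<lambda>i. corr F (s i)) \<longlonglongrightarrow> corr F (of_int z * \<alpha>)"
    unfolding s_def using corr_continuous[OF F] \<alpha>(1)
    by (intro continuous_on_tendsto_compose[of UNIV "corr F"] tendsto_intros) auto
  ultimately show ?thesis using tendsto_add by fastforce
qed

text \<open>Truncating the measure changes the average only where \<open>x - z\<close> leaves the
  window. There are at most \<open>2 * \<bar>z\<bar>\<close> such points, each costing at most
  \<open>C * C\<close>.\<close>

lemma autocorr_approx_tendsto:
  assumes "\<And>x. \<bar>\<mu> x\<bar> \<le> C" "(\<lambda>n. avg n (\<lambda>x. \<mu> x * \<mu> (x - z))) \<longlonglongrightarrow> L"
  shows "(\<lambda>n. autocorr_approx \<mu> n z) \<longlonglongrightarrow> L"
proof -
  have C: "C \<ge> 0" using assms(1)[of 0] by simp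
  define w where "w n x = restr \<mu> n x * restr \<mu> n (x - z) - \<mu> x * \<mu> (x - z)" for n x
  have diff: "\<bar>autocorr_approx \<mu> n z - avg n (\<lambda>x. \<mu> x * \<mu> (x - z))\<bar> \<le> (C * C * (2 * \<bar>z\<bar>)) * inverse (real n + 1)" for n
  proof -
    \<comment> \<open>The set \<open>?J\<close> consists of end zones of length
      \<open>\<bar>z\<bar>\<close> on both sides, which covers either sign of
      \<open>z\<close>.\<close>
    let ?I = "{- int n..int n}" and ?J = "{- int n..<- int n + \<bar>z\<bar>} \<union> {int n - \<bar>z\<bar><..int n}"
    have "\<bar>\<Sum>x\<in>?I. w n x\<bar> \<le> (\<Sum>x\<in>?I. \<bar>w n x\<bar>)" by (rule sum_abs)
    also have "\<dots> \<le> (\<Sum>x\<in>?I. if x \<in> ?J then C * C else 0)"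
    proof (rule sum_mono)
      fix x assume x: "x \<in> ?I"
      have "\<bar>\<mu> x * \<mu> (x - z)\<bar> \<le> C * C"
        unfolding abs_mult using assms(1) C by (intro mult_mono) auto
      then show "\<bar>w n x\<bar> \<le> (if x \<in> ?J then C * C else 0)"
        using x by (auto simp: w_def restr_def)
    qed
    also have "\<dots> = (\<Sum>x\<in>?I \<inter> ?J. C * C)" by (subst sum.inter_restrict) auto
    also have "\<dots> \<le> C * C * (2 * \<bar>z\<bar>)"
    proof -
      have "card (?I \<inter> ?J) \<le> card ?J" by (intro card_mono) auto
      also have "\<dots> \<le> nat \<bar>z\<bar> + nat \<bar>z\<bar>"
        by (rule order_trans[OF card_Un_le]) simp
      finally have "real (card (?I \<inter> ?J)) \<le> 2 * \<bar>z\<bar>" by linarith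
      then show ?thesis using C by (simp add: mult.commute mult_left_mono)
    qed
    finally have "\<bar>\<Sum>x\<in>?I. w n x\<bar> \<le> C * C * (2 * \<bar>z\<bar>)" .
    moreover have "autocorr_approx \<mu> n z - avg n (\<lambda>x. \<mu> x * \<mu> (x - z)) = (\<Sum>x\<in>?I. w n x) / (2 * real n + 1)"
      by (simp add: autocorr_approx_def avg_def w_def sum_subtractf diff_divide_distrib)
    ultimately have "\<bar>autocorr_approx \<mu> n z - avg n (\<lambda>x. \<mu> x * \<mu> (x - z))\<bar> \<le> (C * C * (2 * \<bar>z\<bar>)) / (2 * real n + 1)"
      by (simp add: divide_right_mono)
    also have "\<dots> \<le> (C * C * (2 * \<bar>z\<bar>)) / (real n + 1)"
      using C by (intro divide_left_mono) auto
    finally show ?thesis by (simp add: divide_inverse)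
  qed
  have "(\<lambda>n. (C * C * (2 * \<bar>z\<bar>)) * inverse (real n + 1)) \<longlonglongrightarrow> (C * C * (2 * \<bar>z\<bar>)) * 0"
    using LIMSEQ_inverse_real_of_nat by (intro tendsto_mult_left) (simp add: add.commute)
  then have bound_lim: "(\<lambda>n. (C * C * (2 * \<bar>z\<bar>)) * inverse (real n + 1)) \<longlonglongrightarrow> 0"
    by simp
  have "(\<lambda>n. autocorr_approx \<mu> n z - avg n (\<lambda>x. \<mu> x * \<mu> (x - z))) \<longlonglongrightarrow> 0"
    by (rule Lim_null_comparison[OF _ bound_lim]) (simp only: real_norm_def diff eventually_True)
  from tendsto_add[OF this assms(2)] show ?thesis by simp
qed

section \<open>Diffraction\<close>

lemma circle_lift:
  assumes "continuous_on circle l"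
  shows "trig_sandwiched (\<lambda>t. l (cis (2 * pi * t)))" and "l (cis (2 * pi * frac t)) = l (cis (2 * pi * t))"
proof -
  show "trig_sandwiched (\<lambda>t. l (cis (2 * pi * t)))"
  proof (rule trig_sandwiched_uniform_approx)
    fix e :: real assume "e > 0"
    then show "\<exists>S P. trig_poly S P \<and> (\<forall>t. cmod (l (cis (2 * pi * t)) - P t) < e)"
      using circle_continuous_approx[OF assms[unfolded circle_def]] by metis
  qed
  show "l (cis (2 * pi * frac t)) = l (cis (2 * pi * t))"
    using chr_frac[of 1 t] by (simp add: chr_def)
qed

lemma circleE:
  assumes "x \<in> circle" obtains s where "x = cis (2 * pi * s)"
proof -
  have "x = cis (2 * pi * (Arg x / (2 * pi)))"
    using assms cis_Arg[of x] by (cases "x = 0") (auto simp: circle_def sgn_div_norm)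
  then show ?thesis using that by blast
qed

lemma cis_in_circle [simp]: "cis t \<in> circle"
  by (simp add: circle_def)

lemma conv_tilde_cis: "conv_tilde l (cis (2 * pi * s)) = corr (\<lambda>t. l (cis (2 * pi * t))) s"
proof -
  have "inverse (inverse (cis (2 * pi * t)) * cis (2 * pi * s)) = cis (2 * pi * (t - s))" for t
    by (simp add: cis_inverse cis_mult algebra_simps)
  then show ?thesis by (simp add: conv_tilde_def circ_int_def corr_def)
qed

lemma circ_fourier_eq_fcoeff: "circ_fourier g z = fcoeff (\<lambda>t. g (cis (2 * pi * t))) z"
proof -
  have "cnj (cis (2 * pi * t) powi z) = chr (- z) t" for t
    by (simp add: cis_power_int chr_def cis_cnj mult_ac)
  then show ?thesis by (simp add: circ_fourier_def circ_int_def fcoeff_def)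
qed

text \<open>The Fourier series of the correlation converges uniformly, so its coefficients can be
  read off from finite partial sums.\<close>

lemma fcoeff_corr:
  assumes "trig_sandwiched F" "\<And>t. F (frac t) = F t"
  shows "fcoeff (corr F) z = of_real ((cmod (fcoeff F z))\<^sup>2)"
proof (rule ccontr)
  define d where "d = cmod (fcoeff (corr F) z - of_real ((cmod (fcoeff F z))\<^sup>2))"
  assume "\<not> ?thesis"
  then have "d > 0" by (simp add: d_def)
  then obtain X where X: "finite X" "\<And>S s. finite S \<Longrightarrow> X \<subseteq> S \<Longrightarrow>
     cmod (corr F s - (\<Sum>m\<in>S. of_real ((cmod (fcoeff F m))\<^sup>2) * chr m s)) < d / 2"
    using corr_fpart_bound[OF assms half_gt_zero] by metis
  \<comment> \<open>Adjoining \<open>z\<close> to \<open>X\<close> ensures that the partial sum has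
    the expected coefficient at \<open>z\<close>.\<close>
  define T where "T s = (\<Sum>m\<in>insert z X. of_real ((cmod (fcoeff F m))\<^sup>2) * chr m s)" for s
  have fin: "finite (insert z X)" using X(1) by simp
  have T_int: "(\<lambda>s. T s * chr (- z) s) integrable_on {0..1}"
    unfolding T_def by (intro trig_sandwiched_integrable trig_sandwiched_mult trig_sandwiched_sum trig_sandwiched_cmult trig_sandwiched_chr)
  have c_int: "(\<lambda>s. corr F s * chr (- z) s) integrable_on {0..1}"
    by (intro integrable_continuous_real continuous_intros continuous_on_subset[OF corr_continuous[OF assms]]) auto
  have "cmod (integral {0..1} (\<lambda>s. corr F s * chr (- z) s - T s * chr (- z) s))
      \<le> Re (integral {0..1} (\<lambda>s::real. of_real (d / 2)))"
  proof (rule cmod_integral_le)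
    fix s
    have "cmod (corr F s * chr (- z) s - T s * chr (- z) s) = cmod (corr F s - T s)"
      by (simp add: norm_mult flip: left_diff_distrib)
    then show "cmod (corr F s * chr (- z) s - T s * chr (- z) s) \<le> Re (of_real (d / 2))"
      using X(2)[OF fin, of s] by (simp add: T_def subset_insertI)
  qed (auto intro: integrable_diff c_int T_int)
  moreover have "fcoeff T z = of_real ((cmod (fcoeff F z))\<^sup>2)"
    using fcoeff_trig[OF fin, of "\<lambda>m. of_real ((cmod (fcoeff F m))\<^sup>2)" z] by (simp add: T_def[abs_def])
  ultimately have "d \<le> d / 2"
    by (simp add: integral_diff[OF c_int T_int] d_def fcoeff_def)
  then show False using \<open>d > 0\<close> by simp
qed

text \<open>The Fourier series becomes a uniformly convergent series of integer powers on the circle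
  itself. Continuity there supplies the Borel measurability needed for integration.\<close>

lemma continuous_on_conv_tilde:
  assumes "continuous_on circle l" shows "continuous_on circle (conv_tilde l)"
proof -
  define a where "a m = complex_of_real ((cmod (fcoeff (\<lambda>t. l (cis (2 * pi * t))) m))\<^sup>2)" for m
  have chr_cis: "cis (2 * pi * s) powi m = chr m s" for m s
    by (simp add: cis_power_int chr_def mult_ac)
  show ?thesis
  proof (rule uniform_limit_theorem[where F = "finite_subsets_at_top UNIV"])
    show "\<forall>\<^sub>F S in finite_subsets_at_top UNIV. continuous_on circle (\<lambda>x. \<Sum>m\<in>S. a m * x powi m)"
      by (intro always_eventually allI continuous_intros) (auto simp: circle_def)
    show "uniform_limit circle (\<lambda>S x. \<Sum>m\<in>S. a m * x powi m) (conv_tilde l) (finite_subsets_at_top UNIV)"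
      unfolding uniform_limit_iff eventually_finite_subsets_at_top
    proof (intro allI impI)
      fix e :: real assume "e > 0"
      then obtain X where X: "finite X" "\<And>S s. finite S \<Longrightarrow> X \<subseteq> S \<Longrightarrow>
         cmod (corr (\<lambda>t. l (cis (2 * pi * t))) s - (\<Sum>m\<in>S. a m * chr m s)) < e"
        using corr_fpart_bound[OF circle_lift[OF assms], folded a_def] by blast
      have close: "dist (\<Sum>m\<in>Y. a m * x powi m) (conv_tilde l x) < e" if Y: "finite Y" "X \<subseteq> Y" "x \<in> circle" for Y x
      proof -
        obtain s where s: "x = cis (2 * pi * s)" using circleE[OF Y(3)] by blast
        show ?thesis
          unfolding s conv_tilde_cis chr_cis dist_norm
          by (subst norm_minus_commute) (rule X(2)[OF Y(1,2)])
      qed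
      then show "\<exists>X. finite X \<and> X \<subseteq> UNIV \<and> (\<forall>Y. finite Y \<and> X \<subseteq> Y \<and> Y \<subseteq> UNIV \<longrightarrow>
          (\<forall>x\<in>circle. dist (\<Sum>m\<in>Y. a m * x powi m) (conv_tilde l x) < e))"
        using X(1) close by (intro exI[of _ X]) blast
    qed
  qed simp
qed

text \<open>The measure is the image of a weighted counting measure, so integration pulls back to a
  sum over frequencies. If \<alpha> is rational, several frequencies share one point and their
  masses add.\<close>

lemma pure_point_integral:
  fixes \<phi> :: "complex \<Rightarrow> complex"
  assumes "continuous_on circle \<phi>"
    and "(\<lambda>m. of_real ((cmod (fourier01 f m))\<^sup>2) * \<phi> (cis (2 * pi * \<alpha> * of_int m))) summable_on UNIV"
  shows "integrable (pure_point_diffr f \<alpha>) \<phi>"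
    and "integral\<^sup>L (pure_point_diffr f \<alpha>) \<phi>
      = (\<Sum>\<^sub>\<infinity>m. of_real ((cmod (fourier01 f m))\<^sup>2) * \<phi> (cis (2 * pi * \<alpha> * of_int m)))"
proof -
  let ?b = "\<lambda>m. (cmod (fourier01 f m))\<^sup>2" and ?h = "\<lambda>m::int. cis (2 * pi * \<alpha> * of_int m)"
  let ?D = "density (count_space (UNIV :: int set)) (\<lambda>m. ennreal (?b m))"
  have h: "?h \<in> measurable ?D circle_borel"
    unfolding circle_borel_def by (intro measurable_restrict_space2) auto
  have \<phi>: "\<phi> \<in> borel_measurable circle_borel"
    unfolding circle_borel_def by (rule borel_measurable_continuous_on_restrict[OF assms(1)])
  have eq: "(\<lambda>m. ?b m *\<^sub>R \<phi> (?h m)) = (\<lambda>m. of_real (?b m) * \<phi> (?h m))"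
    by (simp add: scaleR_conv_of_real)
  have abs: "(\<lambda>m. norm (of_real (?b m) * \<phi> (?h m))) summable_on UNIV"
    using assms(2) by (simp only: summable_on_iff_abs_summable_on_complex)
  \<comment> \<open>This is absolute summability in the sense of integrability over counting
    measure, the link between \<open>infsum\<close> and the Lebesgue integral.\<close>
  note set_abs = abs[unfolded abs_summable_equivalent]
  show "integrable (pure_point_diffr f \<alpha>) \<phi>"
    unfolding pure_point_diffr_def
    by (subst integrable_distr_eq[OF h \<phi>], subst integrable_density)
       (use set_abs in \<open>auto simp: eq Infinite_Set_Sum.abs_summable_on_def simp del: of_real_power\<close>)
  have "integral\<^sup>L (pure_point_diffr f \<alpha>) \<phi> = infsetsum (\<lambda>m. of_real (?b m) * \<phi> (?h m)) UNIV"
    unfolding pure_point_diffr_def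
    by (subst integral_distr[OF h \<phi>], subst integral_density) (auto simp: eq infsetsum_def simp del: of_real_power)
  then show "integral\<^sup>L (pure_point_diffr f \<alpha>) \<phi> = (\<Sum>\<^sub>\<infinity>m. of_real (?b m) * \<phi> (?h m))"
    by (simp only: infsetsum_infsum[OF set_abs])
qed

lemma fourier01_eq_fcoeff: "fourier01 f m = fcoeff (\<lambda>t. of_real (f (frac t))) m"
proof -
  have "fcoeff (\<lambda>t. of_real (f (frac t))) m = integral {0..1} (\<lambda>t. complex_of_real (f (frac t)) * chr (- m) (frac t))"
    by (simp add: fcoeff_def)
  also have "\<dots> = fourier01 f m"
    by (subst integral_frac) (simp add: fourier01_def chr_def)
  finally show ?thesis ..
qed

lemma corr_eq_Xi:
  assumes "riemann_int01 f"
  shows "corr (\<lambda>t. of_real (f (frac t))) (of_int z * \<alpha>) = of_real (Xi f \<alpha> z)"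
proof -
  let ?g = "\<lambda>t. f (rot_pow \<alpha> (- z) t) * f (frac t)"
  have eq: "(\<lambda>t. complex_of_real (f (frac t)) * cnj (of_real (f (frac (t - of_int z * \<alpha>))))) = (\<lambda>t. of_real (?g t))"
    by (simp add: rot_pow_def mult.commute)
  have "(\<lambda>t. complex_of_real (?g t)) integrable_on {0..1}"
    using corr_integrable[OF riemann_int01_trig_sandwiched[OF assms], of "of_int z * \<alpha>"] unfolding eq .
  from integrable_linear[OF this bounded_linear_Re] have "?g integrable_on {0..1}"
    by (simp add: o_def)
  from integral_linear[OF this bounded_linear_of_real[where 'a = complex]]
  have "corr (\<lambda>t. of_real (f (frac t))) (of_int z * \<alpha>) = of_real (integral {0..1} ?g)"
    unfolding corr_def eq by (simp add: o_def)
  \<comment> \<open>The integrand of \<open>Xi\<close> has \<open>f x\<close> in place of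
    \<open>f (frac x)\<close>; the two differ at most at the endpoint 1.\<close>
  also have "integral {0..1} ?g = Xi f \<alpha> z"
    unfolding Xi_def by (rule integral_spike[of "{1}"]) (auto simp: frac_eq)
  finally show ?thesis .
qed

lemma has_sum_finite_sum:
  fixes f :: "'a \<Rightarrow> 'b \<Rightarrow> 'c::topological_comm_monoid_add"
  assumes "\<And>i. i \<in> S \<Longrightarrow> (f i has_sum s i) A"
  shows "((\<lambda>m. \<Sum>i\<in>S. f i m) has_sum (\<Sum>i\<in>S. s i)) A"
  using assms by (induction S rule: infinite_finite_induct) (auto intro: has_sum_add)

theorem Xi_diffraction:
  assumes "riemann_int01 f"
  shows "is_diffraction (Xi f \<alpha>) (pure_point_diffr f \<alpha>)"
proof -
  define F where "F t = complex_of_real (f (frac t))" for t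
  have F: "trig_sandwiched F" "\<And>t. F (frac t) = F t"
    unfolding F_def using riemann_int01_trig_sandwiched[OF assms] by auto
  define b where "b m = (cmod (fcoeff F m))\<^sup>2" for m
  have b_fourier: "b m = (cmod (fourier01 f m))\<^sup>2" for m
    by (simp add: b_def fourier01_eq_fcoeff F_def[abs_def])
  have b_sum: "b summable_on UNIV" and b_nonneg: "b m \<ge> 0" for m
    unfolding b_def[abs_def] using fcoeff_square_summable[OF F] by simp_all
  have Xi: "corr F (of_int z * \<alpha>) = of_real (Xi f \<alpha> z)" for z
    unfolding F_def[abs_def] by (rule corr_eq_Xi[OF assms])
  have Xi_sum: "((\<lambda>m. of_real (b m) * chr m (of_int z * \<alpha>)) has_sum of_real (Xi f \<alpha> z)) UNIV" for z
    unfolding Xi[symmetric] b_def by (rule corr_has_sum[OF F])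
  define C where "C = Re (corr F 0)"
  have Xi_bound: "\<bar>Xi f \<alpha> z\<bar> \<le> C" for z
    using norm_corr_le[OF F(1), of "of_int z * \<alpha>"] by (simp add: Xi C_def)
  have "pos_def (Xi f \<alpha>)"
    unfolding pos_def_def Let_def
  proof (intro allI impI)
    fix g :: "int \<Rightarrow> complex" and S :: "int set" assume "finite S"
    let ?s = "\<Sum>x\<in>S. \<Sum>y\<in>S. g x * cnj (g y) * complex_of_real (Xi f \<alpha> (x - y))"
    \<comment> \<open>Expanding \<open>Xi\<close> in its Fourier series turns the quadratic form
      into a sum of nonnegative weights \<open>b m\<close> times squared moduli.\<close>
    have "((\<lambda>m. \<Sum>x\<in>S. \<Sum>y\<in>S. g x * cnj (g y) * (of_real (b m) * chr m (of_int (x - y) * \<alpha>))) has_sum ?s) UNIV"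
      by (intro has_sum_finite_sum has_sum_cmult_right Xi_sum)
    moreover have "(\<Sum>x\<in>S. \<Sum>y\<in>S. g x * cnj (g y) * (of_real (b m) * chr m (of_int (x - y) * \<alpha>)))
        = of_real (b m * (cmod (\<Sum>x\<in>S. g x * chr m (of_int x * \<alpha>)))\<^sup>2)" for m
    proof -
      have "chr m (of_int (x - y) * \<alpha>) = chr m (of_int x * \<alpha>) * cnj (chr m (of_int y * \<alpha>))" for x y
        by (simp add: left_diff_distrib chr_diff cnj_chr)
      moreover have "complex_of_real ((cmod (\<Sum>x\<in>S. g x * chr m (of_int x * \<alpha>)))\<^sup>2)
          = (\<Sum>x\<in>S. \<Sum>y\<in>S. (g x * chr m (of_int x * \<alpha>)) * cnj (g y * chr m (of_int y * \<alpha>)))"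
        unfolding complex_norm_square cnj_sum sum_product ..
      ultimately show ?thesis
        unfolding of_real_mult by (simp add: sum_distrib_left mult_ac del: of_real_power)
    qed
    ultimately have s: "((\<lambda>m. complex_of_real (b m * (cmod (\<Sum>x\<in>S. g x * chr m (of_int x * \<alpha>)))\<^sup>2)) has_sum ?s) UNIV"
      by simp
    have "((\<lambda>m. b m * (cmod (\<Sum>x\<in>S. g x * chr m (of_int x * \<alpha>)))\<^sup>2) has_sum Re ?s) UNIV"
      using has_sum_bounded_linear[OF bounded_linear_Re s] by (simp only: o_def Re_complex_of_real)
    then have "Re ?s \<ge> 0" by (rule has_sum_nonneg) (simp add: b_nonneg)
    moreover have "((\<lambda>m::int. 0) has_sum Im ?s) UNIV"
      using has_sum_bounded_linear[OF bounded_linear_Im s] by (simp only: o_def Im_complex_of_real)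
    then have "Im ?s = 0" by (rule has_sum_unique[OF _ has_sum_0_simp])
    ultimately show "Im ?s = 0 \<and> Re ?s \<ge> 0" by simp
  qed
  moreover have "translation_bounded (Xi f \<alpha>)"
    unfolding translation_bounded_def
  proof (intro allI impI)
    fix K :: "int set"
    have "(\<Sum>k\<in>K. \<bar>Xi f \<alpha> (x + k)\<bar>) \<le> of_nat (card K) * C" for x
      by (rule sum_bounded_above) (rule Xi_bound)
    then show "\<exists>C. \<forall>x. (\<Sum>k\<in>K. \<bar>Xi f \<alpha> (x + k)\<bar>) \<le> C" by blast
  qed
  moreover have "space (pure_point_diffr f \<alpha>) = circle" "sets (pure_point_diffr f \<alpha>) = sets circle_borel"
    by (simp_all add: pure_point_diffr_def circle_borel_def space_restrict_space)
  moreover have "(\<lambda>z. norm (circ_fourier (conv_tilde l) z * complex_of_real (Xi f \<alpha> z))) summable_on UNIV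
      \<and> integrable (pure_point_diffr f \<alpha>) (conv_tilde l)
      \<and> (\<Sum>\<^sub>\<infinity>z. circ_fourier (conv_tilde l) z * complex_of_real (Xi f \<alpha> z))
          = integral\<^sup>L (pure_point_diffr f \<alpha>) (conv_tilde l)"
    if l: "continuous_on circle l" for l
  proof -
    define G where "G t = l (cis (2 * pi * t))" for t
    have G: "trig_sandwiched G" "\<And>t. G (frac t) = G t"
      unfolding G_def using circle_lift[OF l] by auto
    define a where "a z = (cmod (fcoeff G z))\<^sup>2" for z
    have a_sum: "a summable_on UNIV" and a_nonneg: "a z \<ge> 0" for z
      unfolding a_def[abs_def] using fcoeff_square_summable[OF G] by simp_all
    have tilde: "conv_tilde l (cis (2 * pi * s)) = corr G s" for s
      by (simp add: conv_tilde_cis G_def[abs_def])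
    have fourier: "circ_fourier (conv_tilde l) z = of_real (a z)" for z
      unfolding circ_fourier_eq_fcoeff tilde a_def by (rule fcoeff_corr[OF G])
    have tilde_sum: "((\<lambda>z. of_real (a z) * chr z (of_int m * \<alpha>)) has_sum
        conv_tilde l (cis (2 * pi * \<alpha> * of_int m))) UNIV" for m
      using corr_has_sum[OF G, of "of_int m * \<alpha>"] tilde[of "of_int m * \<alpha>"] by (simp add: a_def mult_ac)
    \<comment> \<open>Summing this double array over \<open>m\<close> first gives the side with
      \<open>Xi\<close>; summing over \<open>z\<close> first gives the integral against the point
      masses.\<close>
    define u where "u z m = complex_of_real (a z * b m) * chr m (of_int z * \<alpha>)" for z m
    have u_row: "(\<Sum>\<^sub>\<infinity>m. u z m) = of_real (a z) * of_real (Xi f \<alpha> z)" for z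
      using has_sum_cmult_right[OF Xi_sum, of "of_real (a z)" z]
      by (intro infsumI) (simp add: u_def mult.assoc)
    have u_col: "((\<lambda>z. u z m) has_sum of_real (b m) * conv_tilde l (cis (2 * pi * \<alpha> * of_int m))) UNIV" for m
    proof -
      have "u z m = of_real (b m) * (of_real (a z) * chr z (of_int m * \<alpha>))" for z
        unfolding u_def chr_int_mult[of m] by simp
      then show ?thesis by (simp only: has_sum_cmult_right[OF tilde_sum])
    qed
    have norm_u: "cmod (u z m) = a z * b m" for z m
      using a_nonneg[of z] b_nonneg[of m] by (simp add: u_def norm_mult)
    \<comment> \<open>The moduli form the product array \<open>a z * b m\<close> of two summable
      families, which justifies the exchange.\<close>
    have u_sum: "(\<lambda>(z, m). u z m) summable_on UNIV \<times> UNIV"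
    proof (rule abs_summable_summable, rule iffD2[OF Infinite_Sum.abs_summable_on_Sigma_iff], intro conjI ballI)
      show "(\<lambda>m. norm (case (z, m) of (z, m) \<Rightarrow> u z m)) summable_on UNIV" for z
        by (simp add: norm_u summable_on_cmult_right[OF b_sum])
      have "(\<lambda>z. a z * (\<Sum>\<^sub>\<infinity>m. b m)) summable_on UNIV"
        by (rule summable_on_cmult_left[OF a_sum])
      moreover have "norm (\<Sum>\<^sub>\<infinity>m. norm (case (z, m) of (z, m) \<Rightarrow> u z m)) = a z * (\<Sum>\<^sub>\<infinity>m. b m)" for z
        using a_nonneg[of z] infsum_nonneg[of UNIV b] b_nonneg
        by (simp add: norm_u infsum_cmult_right[OF b_sum] abs_mult)
      ultimately show "(\<lambda>z. norm (\<Sum>\<^sub>\<infinity>m. norm (case (z, m) of (z, m) \<Rightarrow> u z m))) summable_on UNIV"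
        by simp
    qed
    have swap: "(\<Sum>\<^sub>\<infinity>z. \<Sum>\<^sub>\<infinity>m. u z m) = (\<Sum>\<^sub>\<infinity>m. \<Sum>\<^sub>\<infinity>z. u z m)"
      by (rule infsum_swap_banach[OF u_sum])
    have "(\<lambda>z. \<Sum>\<^sub>\<infinity>m. u z m) summable_on UNIV"
      by (rule summable_on_Sigma_banach[OF u_sum])
    then have "(\<lambda>z. norm (circ_fourier (conv_tilde l) z * complex_of_real (Xi f \<alpha> z))) summable_on UNIV"
      unfolding u_row fourier summable_on_iff_abs_summable_on_complex .
    moreover have summable: "(\<lambda>m. of_real ((cmod (fourier01 f m))\<^sup>2) * conv_tilde l (cis (2 * pi * \<alpha> * of_int m))) summable_on UNIV"
    proof -
      have "(\<lambda>(m, z). u z m) summable_on UNIV \<times> UNIV"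
        using u_sum by (subst (asm) summable_on_swap) (simp add: case_prod_unfold)
      from summable_on_Sigma_banach[OF this] show ?thesis
        by (simp only: infsumI[OF u_col] b_fourier)
    qed
    moreover have "(\<Sum>\<^sub>\<infinity>z. circ_fourier (conv_tilde l) z * complex_of_real (Xi f \<alpha> z))
        = integral\<^sup>L (pure_point_diffr f \<alpha>) (conv_tilde l)"
      using swap unfolding u_row infsumI[OF u_col]
      by (simp only: fourier pure_point_integral(2)[OF continuous_on_conv_tilde[OF l] summable] b_fourier)
    ultimately show ?thesis
      using pure_point_integral(1)[OF continuous_on_conv_tilde[OF l] summable] by blast
  qed
  ultimately show ?thesis unfolding is_diffraction_def by blast
qed

section \<open>Autocorrelations of return time measures\<close>

lemma frac_add_int: "frac (x + of_int k) = frac x" for x :: real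
  by (simp add: frac_def)

text \<open>A resonance \<open>m * \<beta> \<in> \<int>\<close> makes the sampled sequence periodic
  with period \<open>\<bar>m\<bar>\<close>; without resonances the orbit is equidistributed.\<close>

lemma avg_orbit_convergent:
  assumes "trig_sandwiched G" "\<And>t. G (frac t) = G t"
  shows "convergent (\<lambda>n. avg n (\<lambda>x. G (y + of_int x * \<beta>)))"
proof (cases "\<exists>m::int. m \<noteq> 0 \<and> of_int m * \<beta> \<in> \<int>")
  case True
  then obtain m :: int where m: "m \<noteq> 0" "of_int m * \<beta> \<in> \<int>" by blast
  have "real (nat \<bar>m\<bar>) * \<beta> \<in> \<int>"
    using m by (cases "m > 0") (auto simp: minus_in_Ints_iff)
  then obtain k where k: "real (nat \<bar>m\<bar>) * \<beta> = of_int k" by (auto elim: Ints_cases)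
  show ?thesis
  proof (rule avg_periodic_convergent)
    show "nat \<bar>m\<bar> > 0" using m by simp
    fix x :: int
    have "y + of_int (x + int (nat \<bar>m\<bar>)) * \<beta> = (y + of_int x * \<beta>) + of_int k"
      using k by (simp add: distrib_right)
    then have "frac (y + of_int (x + int (nat \<bar>m\<bar>)) * \<beta>) = frac (y + of_int x * \<beta>)"
      by (simp only: frac_add_int)
    then show "G (y + of_int (x + int (nat \<bar>m\<bar>)) * \<beta>) = G (y + of_int x * \<beta>)"
      by (metis assms(2))
  qed
next
  case False
  then show ?thesis using avg_trig_sandwiched[OF assms(1), of \<beta> y] by (auto simp: convergent_def)
qed

lemma return_measure_autocorr:
  assumes "riemann_int01 f"
  defines "F \<equiv> (\<lambda>t. complex_of_real (f (frac t)))"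
  shows "autocorr_exists (return_measure f \<beta> y)"
    and "(\<lambda>n. avg n (\<lambda>x. F (y + of_int x * \<beta>) * cnj (F (y + of_int x * \<beta> - of_int z * \<beta>))))
      \<longlonglongrightarrow> of_real (autocorr (return_measure f \<beta> y) z)"
proof -
  let ?\<mu> = "return_measure f \<beta> y"
  have F: "trig_sandwiched F" unfolding F_def by (rule riemann_int01_trig_sandwiched[OF assms(1)])
  obtain C where C: "\<And>t. cmod (F t) \<le> C" using trig_sandwiched_bounded[OF F] by blast
  have \<mu>: "\<bar>?\<mu> x\<bar> \<le> C" for x
    using C[of "y + of_int x * \<beta>"] by (simp add: F_def return_measure_def rot_pow_def)
  have *: "\<exists>L. (\<lambda>n. autocorr_approx ?\<mu> n z) \<longlonglongrightarrow> L \<and>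
     (\<lambda>n. avg n (\<lambda>x. F (y + of_int x * \<beta>) * cnj (F (y + of_int x * \<beta> - of_int z * \<beta>)))) \<longlonglongrightarrow> of_real L" for z
  proof -
    define G where "G t = F t * cnj (F (t - of_int z * \<beta>))" for t
    have "G (frac t) = G t" for t
    proof -
      have "t - of_int z * \<beta> = (frac t - of_int z * \<beta>) + of_int \<lfloor>t\<rfloor>" by (simp add: frac_def)
      then have "frac (frac t - of_int z * \<beta>) = frac (t - of_int z * \<beta>)"
        using frac_add_int by metis
      then show ?thesis by (simp add: G_def F_def)
    qed
    then have "convergent (\<lambda>n. avg n (\<lambda>x. G (y + of_int x * \<beta>)))"
      unfolding G_def by (intro avg_orbit_convergent trig_sandwiched_mult trig_sandwiched_cnj trig_sandwiched_shift F)
    then obtain L where L: "(\<lambda>n. avg n (\<lambda>x. G (y + of_int x * \<beta>))) \<longlonglongrightarrow> L"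
      by (auto simp: convergent_def)
    have "G (y + of_int x * \<beta>) = of_real (?\<mu> x * ?\<mu> (x - z))" for x
      by (simp add: G_def F_def return_measure_def rot_pow_def algebra_simps)
    then have avg_eq: "avg n (\<lambda>x. G (y + of_int x * \<beta>)) = of_real (avg n (\<lambda>x. ?\<mu> x * ?\<mu> (x - z)))" for n
      by (simp only: avg_of_real)
    have Re_lim: "(\<lambda>n. avg n (\<lambda>x. ?\<mu> x * ?\<mu> (x - z))) \<longlonglongrightarrow> Re L"
      using tendsto_Re[OF L] unfolding avg_eq by simp
    \<comment> \<open>The averages are real, so their complex limit is real and can be identified
      with \<open>autocorr\<close>.\<close>
    then have L_real: "L = of_real (Re L)"
      using LIMSEQ_unique[OF L[unfolded avg_eq] tendsto_of_real] by blast
    have "(\<lambda>n. avg n (\<lambda>x. G (y + of_int x * \<beta>))) \<longlonglongrightarrow> of_real (Re L)"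
      unfolding L_real[symmetric] by (rule L)
    then show ?thesis
      using autocorr_approx_tendsto[OF \<mu> Re_lim] unfolding G_def by blast
  qed
  show "autocorr_exists ?\<mu>"
    unfolding autocorr_exists_def convergent_def using * by blast
  show "(\<lambda>n. avg n (\<lambda>x. F (y + of_int x * \<beta>) * cnj (F (y + of_int x * \<beta> - of_int z * \<beta>))))
      \<longlonglongrightarrow> of_real (autocorr ?\<mu> z)"
    using *[of z] unfolding autocorr_def by (auto simp: limI)
qed

theorem theorem4p4:
  fixes f :: "real \<Rightarrow> real" and \<alpha> :: real
    and fs :: "nat \<Rightarrow> real \<Rightarrow> real" and \<alpha>s :: "nat \<Rightarrow> real" and ys :: "nat \<Rightarrow> real"
  assumes f_nonneg: "\<forall>x\<in>{0..<1}. f x \<ge> 0"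
    and f_riemann: "riemann_int01 f"
    and alpha_pos: "\<alpha> > 0"
    and fs_nonneg: "\<forall>i. \<forall>x\<in>{0..<1}. fs i x \<ge> 0"
    and fs_riemann: "\<forall>i. riemann_int01 (fs i)"
    and fs_unif: "uniform_limit {0..<1} fs f sequentially"
    and alphas_pos: "\<forall>i. \<alpha>s i > 0"
    and alphas_lim: "\<alpha>s \<longlonglongrightarrow> \<alpha>"
    and alphas_ne: "\<forall>i. \<alpha>s i \<noteq> \<alpha>"
    and ys_range: "\<forall>i. ys i \<in> {0..<1}"
  shows "(\<forall>i. autocorr_exists (return_measure (fs i) (\<alpha>s i) (ys i)))
       \<and> vague_conv (\<lambda>i. autocorr (return_measure (fs i) (\<alpha>s i) (ys i))) (Xi f \<alpha>)
       \<and> is_diffraction (Xi f \<alpha>) (pure_point_diffr f \<alpha>)"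
proof (intro conjI allI)
  show "autocorr_exists (return_measure (fs i) (\<alpha>s i) (ys i))" for i
    using return_measure_autocorr(1) fs_riemann by blast
  show "is_diffraction (Xi f \<alpha>) (pure_point_diffr f \<alpha>)"
    by (rule Xi_diffraction[OF f_riemann])
  define F where "F t = complex_of_real (f (frac t))" for t
  define H where "H i t = complex_of_real (fs i (frac t))" for i t
  have F: "trig_sandwiched F" "\<And>t. F (frac t) = F t"
    unfolding F_def using riemann_int01_trig_sandwiched[OF f_riemann] by auto
  obtain B where B: "B > 0" "\<And>t. cmod (F t) \<le> B" using trig_sandwiched_bounded[OF F(1)] by blast
  define d where "d i = (SUP t\<in>{0..<1}. \<bar>fs i t - f t\<bar>)" for i
  have HF: "cmod (H i t - F t) \<le> d i" for i t
  proof -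
    have "trig_sandwiched (\<lambda>t. H i t - F t)"
      unfolding H_def using fs_riemann by (intro trig_sandwiched_diff riemann_int01_trig_sandwiched F) auto
    then obtain C where "\<And>t. cmod (H i t - F t) \<le> C" using trig_sandwiched_bounded by blast
    from this[of s for s] have C: "\<bar>fs i (frac s) - f (frac s)\<bar> \<le> C" for s
      by (simp add: H_def F_def flip: of_real_diff)
    \<comment> \<open>The supremum \<open>d i\<close> is an upper bound only for a bounded
      difference, which holds because both functions are sandwiched.\<close>
    have "bdd_above ((\<lambda>t. \<bar>fs i t - f t\<bar>) ` {0..<1})"
      using C by (intro bdd_aboveI2[of _ _ C]) (metis atLeastLessThan_iff frac_eq)
    then have "\<bar>fs i (frac t) - f (frac t)\<bar> \<le> d i"
      unfolding d_def by (intro cSUP_upper) (auto simp: frac_lt_1)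
    then show ?thesis by (simp add: H_def F_def flip: of_real_diff)
  qed
  have d_nonneg: "d i \<ge> 0" for i using HF[of i 0] norm_ge_zero order_trans by blast
  have d: "d \<longlonglongrightarrow> 0"
  proof (rule tendstoI)
    fix e :: real assume "e > 0"
    then have "\<forall>\<^sub>F i in sequentially. \<forall>t\<in>{0..<1}. dist (fs i t) (f t) < e / 2"
      using uniform_limitD[OF fs_unif, of "e / 2"] by simp
    then show "\<forall>\<^sub>F i in sequentially. dist (d i) 0 < e"
    proof eventually_elim
      case (elim i)
      then have "d i \<le> e / 2"
        unfolding d_def by (intro cSUP_least) (auto simp: dist_real_def intro: less_imp_le)
      then show ?case using d_nonneg[of i] \<open>e > 0\<close> by simp
    qed
  qed
  \<comment> \<open>The two terms come from replacing the factors of the product one at a time, with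
    \<open>B\<close> bounding \<open>F\<close> and \<open>B + d i\<close> bounding
    \<open>H i\<close>.\<close>
  define \<eta> where "\<eta> i = B * d i + (B + d i) * d i" for i
  have \<eta>: "\<eta> \<longlonglongrightarrow> 0"
    unfolding \<eta>_def using d by (auto intro!: tendsto_eq_intros)
  show "vague_conv (\<lambda>i. autocorr (return_measure (fs i) (\<alpha>s i) (ys i))) (Xi f \<alpha>)"
    unfolding vague_conv_def
  proof
    fix z
    have "(\<lambda>i. complex_of_real (autocorr (return_measure (fs i) (\<alpha>s i) (ys i)) z)) \<longlonglongrightarrow> corr F (of_int z * \<alpha>)"
    proof (rule autocorrelation_limit[where G = "\<lambda>i t. H i t * cnj (H i (t - of_int z * \<alpha>s i))", OF F alphas_lim alphas_ne _ _ \<eta>])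
      show "(\<lambda>n. avg n (\<lambda>x. H i (ys i + of_int x * \<alpha>s i) * cnj (H i (ys i + of_int x * \<alpha>s i - of_int z * \<alpha>s i))))
          \<longlonglongrightarrow> complex_of_real (autocorr (return_measure (fs i) (\<alpha>s i) (ys i)) z)" for i
        unfolding H_def using return_measure_autocorr(2) fs_riemann by blast
      fix i t
      let ?s = "t - of_int z * \<alpha>s i"
      have "H i t * cnj (H i ?s) - F t * cnj (F ?s) = F t * cnj (H i ?s - F ?s) + cnj (H i ?s) * (H i t - F t)"
        by (simp add: algebra_simps)
      then have "cmod (H i t * cnj (H i ?s) - F t * cnj (F ?s))
          \<le> cmod (F t) * cmod (H i ?s - F ?s) + cmod (H i ?s) * cmod (H i t - F t)"
        by (metis complex_mod_cnj norm_mult norm_triangle_ineq)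
      also have "\<dots> \<le> B * d i + (B + d i) * d i"
      proof (intro add_mono mult_mono)
        show "cmod (H i ?s) \<le> B + d i"
          using norm_triangle_ineq[of "F ?s" "H i ?s - F ?s"] B(2)[of ?s] HF[of i ?s] by simp
      qed (use B HF d_nonneg in auto)
      finally show "cmod (H i t * cnj (H i ?s) - F t * cnj (F ?s)) \<le> \<eta> i"
        by (simp add: \<eta>_def)
    qed
    moreover have "corr F (of_int z * \<alpha>) = of_real (Xi f \<alpha> z)"
      unfolding F_def[abs_def] by (rule corr_eq_Xi[OF f_riemann])
    ultimately show "(\<lambda>i. autocorr (return_measure (fs i) (\<alpha>s i) (ys i)) z) \<longlonglongrightarrow> Xi f \<alpha> z"
      by (simp only: tendsto_of_real_iff)
  qed
qed

end
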